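(* For flags in general position (i.e. for every point of some nonempty Zariski-open subset of the variety $\mathcal{X}_d$ of flag configurations, $d=3,4$), let $\mathcal{E}_3$ and $\mathcal{E}_4$ be the associated toric vector bundles on $\mathbb{P}^2$, and set $$\mathcal{U}_3:=\mathcal{E}_3(9),\qquad \mathcal{U}_4:=\mathcal{E}_4(12).$$ Then $\mathcal{U}_d$ is Ulrich with respect to $\mathcal{O}_{\mathbb{P}^2}(d)$ for $d=3,4$.
   Context: Everything is over $\mathbb{C}$. A vector bundle $\mathcal{U}$ on $\mathbb{P}^2$ is Ulrich with respect to $\mathcal{O}_{\mathbb{P}^2}(d)$ if and only if $\mathrm{H}^i(\mathcal{U}(-d))=0$ and $\mathrm{H}^i(\mathcal{U}(-2d))=0$ for all $i$. The fan of $\mathbb{P}^2$ has rays $\rho_0,\rho_1,\rho_2$ with primitive generators $(1,0),(0,1),(-1,-1)$ and corresponding invariant divisors $D_0,D_1,D_2$. By Klyachko's theorem, toric (i.e. $T$-equivariant, $T=(\mathbb{C}^\times)^2$) vector bundles on $\mathbb{P}^2$ correspond to finite-dimensional vector spaces $E$ (fiber at the identity of $T$) with three decreasing $\mathbb{Z}$-filtrations $E^{\rho_i}(\bullet)$, with $E^{\rho_i}(j)=E$ for $j\ll0$ and $0$ for $j\gg0$ (on $\mathbb{P}^2$ any such filtrations define a bundle). Normalization: $\mathcal{O}(\sum a_iD_i)$ corresponds to $E=\mathbb{C}$, $E^{\rho_i}(j)=\mathbb{C}$ for $j\le a_i$, $0$ for $j>a_i$. Case $d=3$: $E=\mathbb{C}^6$,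 $\mathcal{X}_3=\mathrm{Fl}(1,3,5;6)^2\times\mathrm{Fl}(2,4;6)$. A point is a triple of flags $W_i^1\subset W_i^3\subset W_i^5\subset E$ ($i=0,1$), $W_2^2\subset W_2^4\subset E$ with $\dim W_i^k=k$. The bundle $\mathcal{E}_3$ has filtrations, for $i=0,1$: $E^{\rho_i}(j)=E$ for $j\le-3$, $E^{\rho_i}(-2)=W_i^5$, $E^{\rho_i}(-1)=W_i^3$, $E^{\rho_i}(0)=W_i^1$, $E^{\rho_i}(j)=0$ for $j\ge1$; and $E^{\rho_2}(j)=E$ for $j\le-4$, $E^{\rho_2}(-3)=W_2^4$, $E^{\rho_2}(-2)=W_2^2$, $E^{\rho_2}(j)=0$ for $j\ge-1$. Case $d=4$: $E=\mathbb{C}^4$, $\mathcal{X}_4=\mathrm{Fl}(1,2,3;4)^3$, a point being a triple of complete flags $W_i^1\subset W_i^2\subset W_i^3\subset E$ ($i=0,1,2$), $\dim W_i^k=k$. The bundle $\mathcal{E}_4$ has filtrations, for $i=0,1,2$: $E^{\rho_i}(j)=E$ for $j\le-4$, $E^{\rho_i}(-3)=W_i^3$, $E^{\rho_i}(-2)=W_i^2$, $E^{\rho_i}(-1)=W_i^1$, $E^{\rho_i}(j)=0$ for $j\ge0$. *)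

theory Defs
  imports "HOL-Analysis.Analysis" "HOL-Library.Poly_Mapping"
begin

text \<open>
  Homogeneous coordinates on the projective plane are \<open>x\<^sub>0, x\<^sub>1, x\<^sub>2\<close>, with \<open>D\<^sub>i = {x\<^sub>i = 0}\<close>,
  \<open>U\<^sub>i = {x\<^sub>i \<noteq> 0}\<close> and torus \<open>T = U\<^sub>0 \<inter> U\<^sub>1 \<inter> U\<^sub>2\<close>. The character of \<open>T\<close> with exponent \<open>m\<close> is
  \<open>\<chi>\<^sup>m = (x\<^sub>0 / x\<^sub>2)\<^sup>a (x\<^sub>1 / x\<^sub>2)\<^sup>b\<close> for \<open>m = (a, b)\<close>; its order along \<open>D\<^sub>i\<close> is the pairing of \<open>m\<close> with
  the \<open>i\<close>-th ray generator.
\<close>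

type_synonym character = "int \<times> int"

definition ray :: "nat \<Rightarrow> int \<times> int" where
  "ray i = [(1, 0), (0, 1), (-1, -1)] ! i"

definition pairing :: "character \<Rightarrow> int \<times> int \<Rightarrow> int" where
  "pairing m v = fst m * fst v + snd m * snd v"


section \<open>Sheaves on the projective plane\<close>

text \<open>
  A section over \<open>T\<close> of the trivial bundle with fibre \<open>E\<close> is a Laurent polynomial with
  coefficients in \<open>E\<close>. A vector bundle trivialised over \<open>T\<close> is recorded by its spaces of sections over
  the affine open sets \<open>U\<^sub>I = \<Inter>\<^sub>i\<^sub>\<in>\<^sub>I U\<^sub>i\<close>, \<open>{} \<noteq> I \<subseteq> {0, 1, 2}\<close>, viewed inside the sections over \<open>T\<close>, so that
  the restriction maps are inclusions.
\<close>

type_synonym 'n laurent = "character \<Rightarrow>\<^sub>0 (complex ^ 'n)"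

type_synonym 'n chart_sheaf = "nat set \<Rightarrow> 'n laurent set"

definition mult_char :: "character \<Rightarrow> 'n::finite laurent \<Rightarrow> 'n laurent" where
  "mult_char u s = Poly_Mapping.map_key (\<lambda>m. m - u) s"

lemma lookup_mult_char: "Poly_Mapping.lookup (mult_char u s) m = Poly_Mapping.lookup s (m - u)"
proof -
  have "inj (\<lambda>m. m - u)" by (auto simp: inj_def)
  then show ?thesis by (simp add: mult_char_def map_key.rep_eq)
qed

text \<open>
  \<open>\<O>(k)\<close> is trivialised over \<open>T\<close> by \<open>x\<^sub>2\<^sup>k\<close>. Its local generator \<open>x\<^sub>i\<^sup>k\<close> on \<open>U\<^sub>i\<close> then becomes the character
  \<open>(x\<^sub>i / x\<^sub>2)\<^sup>k\<close>, so that \<open>(F \<otimes> \<O>(k))(U\<^sub>I) = (x\<^sub>i / x\<^sub>2)\<^sup>k F(U\<^sub>I)\<close> for any \<open>i \<in> I\<close>; on \<open>U\<^sub>I\<close> the choice of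
  \<open>i \<in> I\<close> only changes the generator by a unit.
\<close>

definition coord_char :: "nat \<Rightarrow> character" where
  "coord_char i = [(1, 0), (0, 1), (0, 0)] ! i"

definition twist :: "int \<Rightarrow> 'n::finite chart_sheaf \<Rightarrow> 'n chart_sheaf" where
  "twist k F I = (\<Union>i\<in>I. mult_char (k * fst (coord_char i), k * snd (coord_char i)) ` F I)"

text \<open>
  Cech cohomology for the affine cover \<open>U\<^sub>0, U\<^sub>1, U\<^sub>2\<close>, which is the sheaf cohomology since the sheaves
  are quasi-coherent. A \<open>p\<close>-cochain is indexed by the \<open>(p+1)\<close>-element subsets of \<open>{0, 1, 2}\<close>.
\<close>

definition cochains :: "'n::finite chart_sheaf \<Rightarrow> nat \<Rightarrow> (nat set \<Rightarrow> 'n laurent) set" where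
  "cochains F p = {c. \<forall>I. if I \<subseteq> {..<3} \<and> card I = Suc p then c I \<in> F I else c I = 0}"

definition coboundary :: "(nat set \<Rightarrow> 'n::finite laurent) \<Rightarrow> nat set \<Rightarrow> 'n laurent" where
  "coboundary c I =
     (if I \<subseteq> {..<3}
      then \<Sum>k\<in>I. if even (card {j\<in>I. j < k}) then c (I - {k}) else - c (I - {k})
      else 0)"

definition cocycles :: "'n::finite chart_sheaf \<Rightarrow> nat \<Rightarrow> (nat set \<Rightarrow> 'n laurent) set" where
  "cocycles F p = {c \<in> cochains F p. coboundary c = (\<lambda>I. 0)}"

primrec coboundaries :: "'n::finite chart_sheaf \<Rightarrow> nat \<Rightarrow> (nat set \<Rightarrow> 'n laurent) set" where
  "coboundaries F 0 = {\<lambda>I. 0}"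
| "coboundaries F (Suc p) = coboundary ` cochains F p"

definition cohomology :: "'n::finite chart_sheaf \<Rightarrow> nat \<Rightarrow> (nat set \<Rightarrow> 'n laurent) set set" where
  "cohomology F p = cocycles F p //
     {(c, c'). c \<in> cocycles F p \<and> c' \<in> cocycles F p \<and> (\<lambda>I. c I - c' I) \<in> coboundaries F p}"

text \<open>The zero class is the set of coboundaries.\<close>

definition cohomology_vanishes :: "'n::finite chart_sheaf \<Rightarrow> nat \<Rightarrow> bool" where
  "cohomology_vanishes F p \<longleftrightarrow> cohomology F p = {coboundaries F p}"

text \<open>Meant for \<open>F\<close> a vector bundle, with respect to the polarisation \<open>\<O>(d)\<close>; local freeness is presupposed.\<close>

definition ulrich :: "int \<Rightarrow> 'n::finite chart_sheaf \<Rightarrow> bool" where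
  "ulrich d F \<longleftrightarrow>
     (\<forall>p. cohomology_vanishes (twist (- d) F) p) \<and>
     (\<forall>p. cohomology_vanishes (twist (- 2 * d) F) p)"


section \<open>Toric vector bundles\<close>

type_synonym 'n filtrations = "nat \<Rightarrow> int \<Rightarrow> (complex ^ 'n) set"

definition klyachko :: "'n::finite filtrations \<Rightarrow> bool" where
  "klyachko E \<longleftrightarrow> (\<forall>i<3.
     (\<forall>j. vec.subspace (E i j)) \<and> (\<forall>j k. j \<le> k \<longrightarrow> E i k \<subseteq> E i j) \<and>
     (\<exists>j0. \<forall>j\<le>j0. E i j = UNIV) \<and> (\<exists>j0. \<forall>j\<ge>j0. E i j = {0}))"

text \<open>
  The bundle of Klyachko's theorem: the rays of the cone of \<open>U\<^sub>I\<close> are those with index outside \<open>I\<close>, and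
  the coefficient of \<open>\<chi>\<^sup>m\<close> in a section over \<open>U\<^sub>I\<close> lies in the intersection of the \<open>E\<^sup>\<rho>(-\<langle>m, \<rho>\<rangle>)\<close> over
  these rays \<open>\<rho>\<close>. The sign is that of the normalisation in which \<open>\<O>(\<Sum>\<^sub>i a\<^sub>i D\<^sub>i)\<close> has
  \<open>E i j = UNIV\<close> exactly for \<open>j \<le> a\<^sub>i\<close>: \<open>\<chi>\<^sup>m\<close> is a section of that line bundle iff
  \<open>\<langle>m, \<rho>\<^sub>i\<rangle> \<ge> - a\<^sub>i\<close>.
\<close>

definition toric_bundle :: "'n::finite filtrations \<Rightarrow> 'n chart_sheaf" where
  "toric_bundle E I = {s. \<forall>m. \<forall>i\<in>{..<3} - I. Poly_Mapping.lookup s m \<in> E i (- pairing m (ray i))}"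

text \<open>
  The spaces \<open>toric_bundle E I\<close> are modules over the coordinate rings of the \<open>U\<^sub>I\<close>, they are
  localisations of each other as required of a quasi-coherent sheaf, and twisting by \<open>\<O>(k) = \<O>(k D\<^sub>2)\<close>
  shifts the filtration of the last ray.
\<close>

lemma toric_bundle_add:
  assumes "klyachko E" "s \<in> toric_bundle E I" "t \<in> toric_bundle E I"
  shows "s + t \<in> toric_bundle E I"
  using assms by (auto simp: toric_bundle_def klyachko_def Poly_Mapping.lookup_add vec.subspace_add)

lemma toric_bundle_scale:
  assumes "klyachko E" "s \<in> toric_bundle E I"
  shows "Poly_Mapping.map (\<lambda>v. a *s v) s \<in> toric_bundle E I"
  using assms
  by (auto simp: toric_bundle_def klyachko_def map.rep_eq when_def vec.subspace_scale vec.subspace_0)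

lemma toric_bundle_mult_char:
  assumes "klyachko E" "s \<in> toric_bundle E I"
    and "\<And>i. i \<in> {..<3} - I \<Longrightarrow> pairing u (ray i) \<ge> 0"
  shows "mult_char u s \<in> toric_bundle E I"
proof -
  have "Poly_Mapping.lookup s (m - u) \<in> E i (- pairing m (ray i))" if "i \<in> {..<3} - I" for m i
  proof -
    have "Poly_Mapping.lookup s (m - u) \<in> E i (- pairing (m - u) (ray i))"
      using assms(2) that unfolding toric_bundle_def by blast
    moreover have "- pairing m (ray i) \<le> - pairing (m - u) (ray i)"
      using assms(3)[OF that] by (simp add: pairing_def algebra_simps)
    ultimately show ?thesis
      using assms(1) that unfolding klyachko_def by blast
  qed
  then show ?thesis by (simp add: toric_bundle_def lookup_mult_char)
qed

lemma toric_bundle_localization: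
  assumes "klyachko E" and k: "k < 3" and pk: "pairing u (ray k) > 0"
    and p0: "\<And>i. i \<in> {..<3} - insert k I \<Longrightarrow> pairing u (ray i) = 0"
  shows "toric_bundle E (insert k I) =
    {s. \<exists>N::nat. mult_char (int N * fst u, int N * snd u) s \<in> toric_bundle E I}"
proof (intro set_eqI iffI)
  fix s assume s: "s \<in> toric_bundle E (insert k I)"
  obtain j0 where j0: "\<And>j. j \<le> j0 \<Longrightarrow> E k j = UNIV"
    using assms(1) k unfolding klyachko_def by blast
  have sub: "\<And>j. vec.subspace (E k j)" using assms(1) k unfolding klyachko_def by blast
  define B where "B = (\<Sum>m\<in>Poly_Mapping.keys s. \<bar>pairing m (ray k)\<bar>) + \<bar>j0\<bar>"
  have B: "\<bar>pairing m (ray k)\<bar> + \<bar>j0\<bar> \<le> B" if "m \<in> Poly_Mapping.keys s" for m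
    using member_le_sum[of m "Poly_Mapping.keys s" "\<lambda>m. \<bar>pairing m (ray k)\<bar>"] that by (simp add: B_def)
  have B0: "B \<ge> 0" unfolding B_def by (simp add: sum_nonneg)
  define v where "v = (int (nat B) * fst u, int (nat B) * snd u)"
  have pv: "pairing v w = B * pairing u w" for w
    using B0 by (simp add: v_def pairing_def algebra_simps)
  have "Poly_Mapping.lookup s (m - v) \<in> E i (- pairing m (ray i))" if i: "i \<in> {..<3} - I" for m i
  proof (cases "i = k")
    case False
    have "Poly_Mapping.lookup s (m - v) \<in> E i (- pairing (m - v) (ray i))"
      using s i False unfolding toric_bundle_def by blast
    moreover have "pairing (m - v) (ray i) = pairing m (ray i) - pairing v (ray i)"
      by (simp add: pairing_def algebra_simps)
    moreover have "pairing v (ray i) = 0"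
      using p0[of i] i False pv[of "ray i"] by auto
    ultimately show ?thesis by simp
  next
    case True
    show ?thesis
    proof (cases "m - v \<in> Poly_Mapping.keys s")
      case False
      then show ?thesis using sub True by (simp add: in_keys_iff vec.subspace_0)
    next
      case in_keys: True
      have "pairing m (ray k) = pairing (m - v) (ray k) + B * pairing u (ray k)"
        using pv[of "ray k"] by (simp add: pairing_def algebra_simps)
      moreover have "B * pairing u (ray k) \<ge> B" using B0 pk by (simp add: mult_le_cancel_left1)
      ultimately have "- pairing m (ray k) \<le> j0" using B[OF in_keys] by linarith
      then show ?thesis using j0 True by simp
    qed
  qed
  then have "mult_char v s \<in> toric_bundle E I" by (simp add: toric_bundle_def lookup_mult_char)
  then show "s \<in> {s. \<exists>N::nat. mult_char (int N * fst u, int N * snd u) s \<in> toric_bundle E I}"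
    unfolding v_def by blast
next
  fix s assume "s \<in> {s. \<exists>N::nat. mult_char (int N * fst u, int N * snd u) s \<in> toric_bundle E I}"
  then obtain N :: nat where N: "mult_char (int N * fst u, int N * snd u) s \<in> toric_bundle E I"
    by blast
  define v where "v = (int N * fst u, int N * snd u)"
  have pv: "pairing v w = int N * pairing u w" for w
    by (simp add: v_def pairing_def algebra_simps)
  have "Poly_Mapping.lookup s m \<in> E i (- pairing m (ray i))" if i: "i \<in> {..<3} - insert k I" for m i
  proof -
    have "Poly_Mapping.lookup (mult_char v s) (m + v) \<in> E i (- pairing (m + v) (ray i))"
      using N i unfolding v_def toric_bundle_def by blast
    moreover have "pairing (m + v) (ray i) = pairing m (ray i) + pairing v (ray i)"
      by (simp add: pairing_def algebra_simps)
    moreover have "pairing v (ray i) = 0" using p0[OF i] pv[of "ray i"] by simp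
    ultimately show ?thesis by (simp add: lookup_mult_char)
  qed
  then show "s \<in> toric_bundle E (insert k I)" by (simp add: toric_bundle_def)
qed

lemma twist_toric_bundle:
  assumes "I \<subseteq> {..<3}" "I \<noteq> {}"
  shows "twist k (toric_bundle E) I =
    toric_bundle (\<lambda>i j. if i = 2 then E i (j - k) else E i j) I"
    (is "_ = toric_bundle ?E' I")
proof -
  have *: "mult_char (k * fst (coord_char i), k * snd (coord_char i)) ` toric_bundle E I =
      toric_bundle ?E' I" if "i \<in> I" for i
  proof -
    let ?v = "(k * fst (coord_char i), k * snd (coord_char i))"
    have i3: "i = 0 \<or> i = 1 \<or> i = 2" using assms(1) that by auto
    have pv: "pairing ?v (ray l) = (if l = 2 then - k else 0)" if l: "l \<in> {..<3} - I" for l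
    proof -
      have "l \<noteq> i" using l \<open>i \<in> I\<close> by auto
      moreover have "l = 0 \<or> l = 1 \<or> l = 2" using l by auto
      ultimately show ?thesis
        using i3 by (auto simp: pairing_def ray_def coord_char_def numeral_2_eq_2)
    qed
    have shift: "?E' l (- pairing (m + ?v) (ray l)) = E l (- pairing m (ray l))"
      if "l \<in> {..<3} - I" for l m
    proof -
      have "pairing (m + ?v) (ray l) = pairing m (ray l) + pairing ?v (ray l)"
        by (simp add: pairing_def algebra_simps)
      then show ?thesis using pv[OF that] by (cases "l = 2") simp_all
    qed
    have mem: "mult_char ?v s \<in> toric_bundle ?E' I \<longleftrightarrow> s \<in> toric_bundle E I" for s
    proof -
      have "mult_char ?v s \<in> toric_bundle ?E' I \<longleftrightarrow>
          (\<forall>m. \<forall>l\<in>{..<3} - I. Poly_Mapping.lookup s (m - ?v) \<in> ?E' l (- pairing m (ray l)))"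
        unfolding toric_bundle_def mem_Collect_eq lookup_mult_char ..
      also have "\<dots> \<longleftrightarrow>
          (\<forall>m. \<forall>l\<in>{..<3} - I. Poly_Mapping.lookup s m \<in> ?E' l (- pairing (m + ?v) (ray l)))"
        by (metis (no_types, lifting) add_diff_cancel diff_add_cancel)
      also have "\<dots> \<longleftrightarrow> s \<in> toric_bundle E I"
        unfolding toric_bundle_def mem_Collect_eq using shift by (metis (no_types, lifting))
      finally show ?thesis .
    qed
    have "t = mult_char ?v (mult_char (- ?v) t)" for t :: "'a laurent"
      by (rule poly_mapping_eqI) (simp add: lookup_mult_char del: uminus_Pair)
    then show ?thesis using mem by (metis (no_types, lifting) image_iff set_eqI)
  qed
  show ?thesis
    using * assms(2) unfolding twist_def by (metis (no_types, lifting) SUP_eq_const)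
qed


section \<open>Flag configurations and general position\<close>

text \<open>
  A partial flag with dimensions in \<open>K\<close> is a family \<open>W\<close> of subspaces, \<open>W k\<close> being the one of dimension
  \<open>k \<in> K\<close>; \<open>flags K\<close> is \<open>Fl(k\<^sub>1, \<dots>, k\<^sub>r; n)\<close> for \<open>K = {k\<^sub>1 < \<dots> < k\<^sub>r}\<close> and \<open>n = CARD('n)\<close>.
\<close>

definition flags :: "nat set \<Rightarrow> (nat \<Rightarrow> (complex ^ 'n::finite) set) set" where
  "flags K = {W \<in> extensional K.
     (\<forall>k\<in>K. vec.subspace (W k) \<and> vec.dim (W k) = k) \<and> (\<forall>j\<in>K. \<forall>k\<in>K. j \<le> k \<longrightarrow> W j \<subseteq> W k)}"

type_synonym 'n flag_triple = "nat \<Rightarrow> nat \<Rightarrow> (complex ^ 'n) set"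

definition flag_triples :: "(nat \<Rightarrow> nat set) \<Rightarrow> 'n::finite flag_triple set" where
  "flag_triples K = (\<Pi>\<^sub>E i\<in>{..<3}. flags (K i))"

text \<open>
  The Zariski topology on a product of three flag varieties is the quotient topology for
  \<open>GL\<^sub>n \<times> GL\<^sub>n \<times> GL\<^sub>n \<rightarrow> \<Prod>\<^sub>i GL\<^sub>n / P\<^sub>i\<close>, which sends a triple of ordered bases of \<open>\<complex>\<^sup>n\<close> to the flags spanned
  by their initial segments. Thus a set is open iff its preimage is cut out, inside the triples of
  bases, by the nonvanishing of at least one of a set of polynomials in the coordinates of the basis
  vectors.
\<close>

definition basis_seq :: "(nat \<Rightarrow> complex ^ 'n::finite) \<Rightarrow> bool" where
  "basis_seq b \<longleftrightarrow> inj_on b {..<CARD('n)} \<and> vec.independent (b ` {..<CARD('n)})"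

definition flag_of :: "nat set \<Rightarrow> (nat \<Rightarrow> complex ^ 'n::finite) \<Rightarrow> nat \<Rightarrow> (complex ^ 'n) set" where
  "flag_of K b = (\<lambda>k\<in>K. vec.span (b ` {..<k}))"

inductive_set basis_polys :: "((nat \<Rightarrow> nat \<Rightarrow> complex ^ 'n::finite) \<Rightarrow> complex) set" where
  const: "(\<lambda>b. c) \<in> basis_polys"
| coord: "i < 3 \<Longrightarrow> k < CARD('n) \<Longrightarrow> (\<lambda>b. b i k $ l) \<in> basis_polys"
| add: "p \<in> basis_polys \<Longrightarrow> q \<in> basis_polys \<Longrightarrow> (\<lambda>b. p b + q b) \<in> basis_polys"
| mult: "p \<in> basis_polys \<Longrightarrow> q \<in> basis_polys \<Longrightarrow> (\<lambda>b. p b * q b) \<in> basis_polys"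

definition zariski_open :: "(nat \<Rightarrow> nat set) \<Rightarrow> 'n::finite flag_triple set \<Rightarrow> bool" where
  "zariski_open K U \<longleftrightarrow> U \<subseteq> flag_triples K \<and>
     (\<exists>S\<subseteq>basis_polys. \<forall>b. (\<forall>i<3. basis_seq (b i)) \<longrightarrow>
        ((\<lambda>i\<in>{..<3}. flag_of (K i) (b i)) \<in> U \<longleftrightarrow> (\<exists>p\<in>S. p b \<noteq> 0)))"

definition dims3 :: "nat \<Rightarrow> nat set" where
  "dims3 i = (if i = 2 then {2, 4} else {1, 3, 5})"

definition dims4 :: "nat \<Rightarrow> nat set" where
  "dims4 i = {1, 2, 3}"

definition filt3 :: "6 flag_triple \<Rightarrow> 6 filtrations" where
  "filt3 W i j =
     (if i = 2 then
        if j \<le> -4 then UNIV else if j = -3 then W i 4 else if j = -2 then W i 2 else {0}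
      else
        if j \<le> -3 then UNIV else if j = -2 then W i 5 else if j = -1 then W i 3
        else if j = 0 then W i 1 else {0})"

definition filt4 :: "4 flag_triple \<Rightarrow> 4 filtrations" where
  "filt4 W i j =
     (if j \<le> -4 then UNIV else if j = -3 then W i 3 else if j = -2 then W i 2
      else if j = -1 then W i 1 else {0})"

definition bundle3 :: "6 flag_triple \<Rightarrow> 6 chart_sheaf" where
  "bundle3 W = toric_bundle (filt3 W)"

definition bundle4 :: "4 flag_triple \<Rightarrow> 4 chart_sheaf" where
  "bundle4 W = toric_bundle (filt4 W)"

lemma klyachko_filt3:
  assumes "W \<in> flag_triples dims3"
  shows "klyachko (filt3 W)"
  unfolding klyachko_def
proof (intro allI impI)
  fix i :: nat assume "i < 3"
  then have "W i \<in> flags (dims3 i)" using assms by (auto simp: flag_triples_def)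
  then have sub: "\<And>k. k \<in> dims3 i \<Longrightarrow> vec.subspace (W i k)"
    and mono: "\<And>j k. j \<in> dims3 i \<Longrightarrow> k \<in> dims3 i \<Longrightarrow> j \<le> k \<Longrightarrow> W i j \<subseteq> W i k"
    unfolding flags_def by blast+
  have 1: "\<forall>j. vec.subspace (filt3 W i j)"
    using sub by (auto simp: filt3_def dims3_def)
  have z: "\<And>k. k \<in> dims3 i \<Longrightarrow> 0 \<in> W i k" using sub vec.subspace_0 by blast
  have step: "filt3 W i (j + 1) \<subseteq> filt3 W i j" for j
    using mono[of 1 3] mono[of 3 5] mono[of 2 4] z
    by (auto simp: filt3_def dims3_def split: if_splits)
  have 2: "filt3 W i k \<subseteq> filt3 W i j" if "j \<le> k" for j k
    using that by (induction rule: int_ge_induct) (use step in blast)+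
  have 3: "\<forall>j\<le>-4. filt3 W i j = UNIV" "\<forall>j\<ge>1. filt3 W i j = {0}"
    by (auto simp: filt3_def)
  show "(\<forall>j. vec.subspace (filt3 W i j)) \<and> (\<forall>j k. j \<le> k \<longrightarrow> filt3 W i k \<subseteq> filt3 W i j) \<and>
     (\<exists>j0. \<forall>j\<le>j0. filt3 W i j = UNIV) \<and> (\<exists>j0. \<forall>j\<ge>j0. filt3 W i j = {0})"
    using 1 2 3 by blast
qed

lemma klyachko_filt4:
  assumes "W \<in> flag_triples dims4"
  shows "klyachko (filt4 W)"
  unfolding klyachko_def
proof (intro allI impI)
  fix i :: nat assume "i < 3"
  then have "W i \<in> flags (dims4 i)" using assms by (auto simp: flag_triples_def)
  then have sub: "\<And>k. k \<in> dims4 i \<Longrightarrow> vec.subspace (W i k)"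
    and mono: "\<And>j k. j \<in> dims4 i \<Longrightarrow> k \<in> dims4 i \<Longrightarrow> j \<le> k \<Longrightarrow> W i j \<subseteq> W i k"
    unfolding flags_def by blast+
  have 1: "\<forall>j. vec.subspace (filt4 W i j)"
    using sub by (auto simp: filt4_def dims4_def)
  have z: "\<And>k. k \<in> dims4 i \<Longrightarrow> 0 \<in> W i k" using sub vec.subspace_0 by blast
  have step: "filt4 W i (j + 1) \<subseteq> filt4 W i j" for j
    using mono[of 1 2] mono[of 2 3] z
    by (auto simp: filt4_def dims4_def split: if_splits)
  have 2: "filt4 W i k \<subseteq> filt4 W i j" if "j \<le> k" for j k
    using that by (induction rule: int_ge_induct) (use step in blast)+
  have 3: "\<forall>j\<le>-4. filt4 W i j = UNIV" "\<forall>j\<ge>0. filt4 W i j = {0}"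
    by (auto simp: filt4_def)
  show "(\<forall>j. vec.subspace (filt4 W i j)) \<and> (\<forall>j k. j \<le> k \<longrightarrow> filt4 W i k \<subseteq> filt4 W i j) \<and>
     (\<exists>j0. \<forall>j\<le>j0. filt4 W i j = UNIV) \<and> (\<exists>j0. \<forall>j\<ge>j0. filt4 W i j = {0})"
    using 1 2 3 by blast
qed

end

theory Submission
  imports Defs
begin

text \<open>
  Cech cohomology of a toric bundle is graded by the characters \<open>m\<close> of the torus, and in degree \<open>m\<close>
  the Cech complex only involves the three subspaces \<open>V\<^sub>i = E\<^sup>\<rho>\<^sub>i(- \<langle>m, \<rho>\<^sub>i\<rangle>)\<close>: it is
  \<open>\<Oplus> (V\<^sub>i \<inter> V\<^sub>j) \<rightarrow> \<Oplus> V\<^sub>i \<rightarrow> E\<close>. All cohomology vanishes iff these complexes are exact, that is, iff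
  \<open>V\<^sub>0 \<inter> V\<^sub>1 \<inter> V\<^sub>2 = 0\<close>, \<open>V\<^sub>0 + V\<^sub>1 + V\<^sub>2 = E\<close> and \<open>V\<^sub>0 \<inter> (V\<^sub>1 + V\<^sub>2)\<close> is the sum of \<open>V\<^sub>0 \<inter> V\<^sub>1\<close> and
  \<open>V\<^sub>0 \<inter> V\<^sub>2\<close>. The implication that is used is \<open>cech_cohomology_vanishes\<close>.

  Let \<open>n = dim E\<close>, and index the steps of a flag by their dimension, with \<open>0\<close> for a nonpositive
  index and all of \<open>E\<close> for an index that is at least \<open>n\<close>. What makes the two bundles Ulrich is that
  their filtrations jump linearly in this indexing: \<open>E\<^sup>\<rho>\<^sub>i(j)\<close> is the step with index \<open>c\<^sub>i - r j\<close>,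
  where \<open>\<Sum> c\<^sub>i = 0\<close>, with \<open>r = 2\<close>, \<open>c = (1, 1, -2)\<close> for \<open>d = 3\<close> and \<open>r = 1\<close>, \<open>c = 0\<close> for \<open>d = 4\<close>.
  Because \<open>\<rho>\<^sub>0 + \<rho>\<^sub>1 + \<rho>\<^sub>2 = 0\<close>, the three indices that occur in degree \<open>m\<close> after a twist by \<open>t\<close> add
  up to \<open>r t\<close>, whatever \<open>m\<close> is. For the two twists in the Ulrich condition this number is \<open>2 n\<close> and
  \<open>n\<close>.

  If the indices add up to \<open>n\<close> and lie in \<open>[0, n]\<close>, then for general flags \<open>E\<close> is the direct sum of
  the \<open>V\<^sub>i\<close>. If they add up to \<open>2 n\<close> and lie in \<open>[0, n]\<close>, then for general flags the \<open>V\<^sub>i\<close> meet in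
  \<open>0\<close>, whence \<open>(V\<^sub>0 \<inter> V\<^sub>1) \<oplus> V\<^sub>2 = E\<close>. Either way the complex is exact. An index outside \<open>[0, n]\<close>
  makes one \<open>V\<^sub>i\<close> equal to \<open>0\<close> or \<open>E\<close>, and what remains to be shown about the other two follows by
  moving that index by \<open>n\<close>, which exchanges the two cases (\<open>exact_sum_n\<close>, \<open>exact_sum_2n\<close>).

  It remains to see that general position in this sense is an open condition and can be realised.
  Each of the finitely many conditions is the nonvanishing of a determinant
  (\<open>principal_open_no_relation\<close>). All of them hold for the standard flag, the opposite flag and the
  flag formed by the values at \<open>0, \<dots>, n - 1\<close> of the polynomials of degree less than \<open>k\<close>
  (\<open>exists_general_position\<close>).
\<close>

section \<open>Exactness in a single degree\<close>

definition sum_is_full :: "(complex ^ 'n::finite) set \<Rightarrow> (complex ^ 'n) set \<Rightarrow> bool" where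
  "sum_is_full A B \<longleftrightarrow> (\<forall>x. \<exists>a\<in>A. x - a \<in> B)"

text \<open>
  The third clause is the modular law \<open>A \<inter> (B + C) \<subseteq> (A \<inter> B) + C\<close>. Exactness in the middle amounts
  to it: if \<open>a = y + c\<close> with \<open>y \<in> A \<inter> B\<close> and \<open>c \<in> C\<close>, then \<open>c = a - y\<close> lies in \<open>A \<inter> C\<close>
  automatically.
\<close>
definition cech_exact ::
  "(complex ^ 'n::finite) set \<Rightarrow> (complex ^ 'n) set \<Rightarrow> (complex ^ 'n) set \<Rightarrow> bool" where
  "cech_exact A B C \<longleftrightarrow>
     A \<inter> B \<inter> C \<subseteq> {0} \<and>
     (\<forall>x. \<exists>a\<in>A. \<exists>b\<in>B. x - a - b \<in> C) \<and>
     (\<forall>a\<in>A. \<forall>b\<in>B. a - b \<in> C \<longrightarrow> (\<exists>y\<in>A \<inter> B. a - y \<in> C))"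

lemma cech_exact_swap12:
  assumes "vec.subspace A" "vec.subspace B" "vec.subspace C" "cech_exact A B C"
  shows "cech_exact B A C"
  unfolding cech_exact_def
proof (intro conjI allI ballI impI)
  show "B \<inter> A \<inter> C \<subseteq> {0}" using assms(4) by (auto simp: cech_exact_def)
  fix x
  obtain a b where "a \<in> A" "b \<in> B" "x - a - b \<in> C" using assms(4) unfolding cech_exact_def by blast
  moreover have "x - b - a = x - a - b" by simp
  ultimately show "\<exists>b\<in>B. \<exists>a\<in>A. x - b - a \<in> C" by metis
next
  fix b a assume ab: "b \<in> B" "a \<in> A" "b - a \<in> C"
  then have "a - b \<in> C" using vec.subspace_neg[OF assms(3), of "b - a"] by simp
  then obtain y where y: "y \<in> A \<inter> B" "a - y \<in> C"
    using ab assms(4) unfolding cech_exact_def by blast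
  have "(b - a) + (a - y) \<in> C" by (intro vec.subspace_add assms ab y)
  then show "\<exists>y\<in>B \<inter> A. b - y \<in> C" using y by auto
qed

lemma cech_exact_swap23:
  assumes "vec.subspace A" "vec.subspace B" "vec.subspace C" "cech_exact A B C"
  shows "cech_exact A C B"
  unfolding cech_exact_def
proof (intro conjI allI ballI impI)
  show "A \<inter> C \<inter> B \<subseteq> {0}" using assms(4) by (auto simp: cech_exact_def)
  fix x
  obtain a b where "a \<in> A" "b \<in> B" "x - a - b \<in> C" using assms(4) unfolding cech_exact_def by blast
  then show "\<exists>a\<in>A. \<exists>c\<in>C. x - a - c \<in> B" by (intro bexI[of _ a] bexI[of _ "x - a - b"]) auto
next
  fix a c assume ac: "a \<in> A" "c \<in> C" "a - c \<in> B"
  moreover have "a - (a - c) \<in> C" using ac by simp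
  ultimately obtain y where y: "y \<in> A \<inter> B" "a - y \<in> C"
    using assms(4) unfolding cech_exact_def by blast
  then have "a - y \<in> A" using ac vec.subspace_diff[OF assms(1)] by simp
  then show "\<exists>y\<in>A \<inter> C. a - y \<in> B" using y by (intro bexI[of _ "a - y"]) simp_all
qed

lemma three_indices_distinct:
  assumes "{i, j, k} = {..<3::nat}"
  shows "i \<noteq> j" "j \<noteq> k" "i \<noteq> k"
proof -
  have "card {i, j, k} = 3" unfolding assms by simp
  then show "i \<noteq> j" "j \<noteq> k" "i \<noteq> k" by (auto simp: card_insert_if split: if_splits)
qed

text \<open>Allows the special role of one of the three subspaces to be given to any of them.\<close>
lemma cech_exact_permute:
  assumes V: "\<And>i. i < 3 \<Longrightarrow> vec.subspace (V i)"
    and ijk: "{i, j, k} = {..<3::nat}" and ex: "cech_exact (V i) (V j) (V k)"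
  shows "cech_exact (V 0) (V 1) (V 2)"
proof -
  note distinct = three_indices_distinct[OF ijk]
  have lt: "i < 3 \<and> j < 3 \<and> k < 3"
    unfolding lessThan_iff[symmetric] ijk[symmetric] by simp
  have in3: "i = 0 \<or> i = 1 \<or> i = 2" "j = 0 \<or> j = 1 \<or> j = 2" "k = 0 \<or> k = 1 \<or> k = 2"
    using lt by auto
  have 12: "cech_exact (V b) (V a) (V c)" if "cech_exact (V a) (V b) (V c)" "a < 3" "b < 3" "c < 3"
    for a b c
    using cech_exact_swap12[OF V V V that(1)] that by simp
  have 23: "cech_exact (V a) (V c) (V b)" if "cech_exact (V a) (V b) (V c)" "a < 3" "b < 3" "c < 3"
    for a b c
    using cech_exact_swap23[OF V V V that(1)] that by simp
  consider "i = 0" "j = 1" "k = 2" | "i = 0" "j = 2" "k = 1" | "i = 1" "j = 0" "k = 2"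
    | "i = 1" "j = 2" "k = 0" | "i = 2" "j = 0" "k = 1" | "i = 2" "j = 1" "k = 0"
    using in3 distinct that by (elim disjE) simp_all
  then show ?thesis
  proof cases
    case 1 then show ?thesis using ex by simp
  next
    case 2 then show ?thesis using 23[OF ex] by simp
  next
    case 3 then show ?thesis using 12[OF ex] by simp
  next
    case 4
    then have "cech_exact (V 1) (V 0) (V 2)" using 23[OF ex] by simp
    then show ?thesis using 12 by simp
  next
    case 5
    then have "cech_exact (V 0) (V 2) (V 1)" using 12[OF ex] by simp
    then show ?thesis using 23 by simp
  next
    case 6
    then have "cech_exact (V 1) (V 2) (V 0)" using 12[OF ex] by simp
    then have "cech_exact (V 1) (V 0) (V 2)" using 23 by simp
    then show ?thesis using 12 by simp
  qed
qed

lemma cech_exact_zero: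
  assumes "A = {0}" "vec.subspace B" "vec.subspace C" "sum_is_full B C"
  shows "cech_exact A B C"
  using assms(1,4) vec.subspace_0[OF assms(2)] vec.subspace_0[OF assms(3)]
  unfolding cech_exact_def sum_is_full_def by simp

lemma cech_exact_full:
  assumes "A = UNIV" "vec.subspace B" "vec.subspace C" "B \<inter> C \<subseteq> {0}"
  shows "cech_exact A B C"
  unfolding cech_exact_def
proof (intro conjI allI ballI impI)
  show "\<exists>a\<in>A. \<exists>b\<in>B. x - a - b \<in> C" for x
    using assms vec.subspace_0 by (intro bexI[of _ x] bexI[of _ 0]) auto
qed (use assms in auto)

lemma sum_is_full_sym:
  assumes "sum_is_full A B" shows "sum_is_full B A"
  unfolding sum_is_full_def
proof
  fix x
  obtain a where "a \<in> A" "x - a \<in> B" using assms by (auto simp: sum_is_full_def)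
  then show "\<exists>b\<in>B. x - b \<in> A" by (intro bexI[of _ "x - a"]) auto
qed

lemma sum_is_full_mono:
  assumes "sum_is_full A B" "A \<subseteq> A'" "B \<subseteq> B'" shows "sum_is_full A' B'"
  using assms unfolding sum_is_full_def by blast

lemma sum_is_full_UNIV:
  assumes "vec.subspace A" shows "sum_is_full A UNIV" "sum_is_full UNIV A"
proof -
  show "sum_is_full A UNIV" using vec.subspace_0[OF assms] by (auto simp: sum_is_full_def)
  then show "sum_is_full UNIV A" by (rule sum_is_full_sym)
qed

lemma dim_inter_ge:
  assumes "vec.subspace A" "vec.subspace (B :: (complex ^ 'n::finite) set)"
  shows "vec.dim A + vec.dim B \<le> vec.dim (A \<inter> B) + CARD('n)"
  using vec.dim_sums_Int[OF assms] vec.dim_subset_UNIV[of "{x + y |x y. x \<in> A \<and> y \<in> B}"]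
  unfolding vec.dimension_def card_cart_basis by linarith

lemma sum_is_full_dim:
  assumes "vec.subspace A" "vec.subspace (B :: (complex ^ 'n::finite) set)" "A \<inter> B \<subseteq> {0}"
    "vec.dim A + vec.dim B \<ge> CARD('n)"
  shows "sum_is_full A B"
proof -
  let ?S = "{x + y |x y. x \<in> A \<and> y \<in> B}"
  have "vec.dim (A \<inter> B) = 0" using assms(3) vec.dim_eq_0 by blast
  then have "vec.dim ?S \<ge> vec.dim (UNIV :: (complex ^ 'n::finite) set)"
    using vec.dim_sums_Int[OF assms(1,2)] assms(4) unfolding vec_dim_card by linarith
  then have "?S = UNIV"
    using vec.subspace_sums[OF assms(1,2)] by (intro vec.subspace_dim_equal) auto
  show ?thesis unfolding sum_is_full_def
  proof (intro allI)
    fix x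
    obtain a b where "x = a + b" "a \<in> A" "b \<in> B" using \<open>?S = UNIV\<close> by blast
    then show "\<exists>a\<in>A. x - a \<in> B" by (intro bexI[of _ a]) auto
  qed
qed

text \<open>
  A direct sum decomposition: the three subspaces fill \<open>E\<close> for reasons of dimension, and
  independence leaves only \<open>a = 0\<close> in the modular law.
\<close>
lemma cech_exact_independent:
  assumes sub: "vec.subspace A" "vec.subspace B" "vec.subspace (C :: (complex ^ 'n::finite) set)"
    and ind: "\<And>a b c. a \<in> A \<Longrightarrow> b \<in> B \<Longrightarrow> c \<in> C \<Longrightarrow> a + b + c = 0 \<Longrightarrow> a = 0 \<and> b = 0 \<and> c = 0"
    and dim: "vec.dim A + vec.dim B + vec.dim C = CARD('n)"
  shows "cech_exact A B C"
  unfolding cech_exact_def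
proof (intro conjI allI ballI impI)
  note z = sub[THEN vec.subspace_0]
  note n = sub[THEN vec.subspace_neg]
  have AB: "A \<inter> B \<subseteq> {0}"
  proof
    fix x assume "x \<in> A \<inter> B"
    then show "x \<in> {0}" using ind[of x "-x" 0] z(3) n(2)[of x] by auto
  qed
  then show "A \<inter> B \<inter> C \<subseteq> {0}" by blast
  let ?S = "{x + y |x y. x \<in> A \<and> y \<in> B}"
  have "vec.dim (A \<inter> B) = 0" using AB vec.dim_eq_0 by blast
  then have "vec.dim ?S = vec.dim A + vec.dim B" using vec.dim_sums_Int[OF sub(1,2)] by linarith
  moreover have "?S \<inter> C \<subseteq> {0}"
  proof
    fix s assume "s \<in> ?S \<inter> C"
    then obtain x y where "x \<in> A" "y \<in> B" "s = x + y" "s \<in> C" by blast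
    then show "s \<in> {0}" using ind[of x y "-s"] n(3)[of s] by auto
  qed
  ultimately have "sum_is_full ?S C"
    using vec.subspace_sums[OF sub(1,2)] sub(3) dim by (intro sum_is_full_dim) auto
  then show "\<exists>a\<in>A. \<exists>b\<in>B. x - a - b \<in> C" for x
  proof -
    obtain a b where "a \<in> A" "b \<in> B" "x - (a + b) \<in> C"
      using \<open>sum_is_full ?S C\<close> unfolding sum_is_full_def by blast
    then show ?thesis by (auto simp: diff_diff_eq)
  qed
  fix a b assume "a \<in> A" "b \<in> B" "a - b \<in> C"
  then have "a = 0" using ind[of a "-b" "-(a-b)"] n(2)[of b] n(3)[of "a - b"] by auto
  then show "\<exists>y\<in>A \<inter> B. a - y \<in> C" using z by (intro bexI[of _ 0]) auto
qed

text \<open>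
  Since \<open>dim (A \<inter> B) \<ge> dim A + dim B - n = n - dim C\<close>, the subspaces \<open>A \<inter> B\<close> and \<open>C\<close> are large
  enough to fill \<open>E\<close> as soon as they meet in \<open>0\<close>.
\<close>
lemma inter_complementary:
  assumes sub: "vec.subspace A" "vec.subspace B" "vec.subspace (C :: (complex ^ 'n::finite) set)"
    and int: "A \<inter> B \<inter> C \<subseteq> {0}"
    and dim: "vec.dim A + vec.dim B + vec.dim C = 2 * CARD('n)"
  shows "sum_is_full (A \<inter> B) C"
proof (rule sum_is_full_dim)
  show "CARD('n) \<le> vec.dim (A \<inter> B) + vec.dim C" using dim_inter_ge[OF sub(1,2)] dim by linarith
qed (use sub int vec.subspace_inter in simp_all)

lemma cech_exact_transversal:
  assumes sub: "vec.subspace A" "vec.subspace B" "vec.subspace (C :: (complex ^ 'n::finite) set)"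
    and int: "A \<inter> B \<inter> C \<subseteq> {0}"
    and dim: "vec.dim A + vec.dim B + vec.dim C = 2 * CARD('n)"
  shows "cech_exact A B C"
  unfolding cech_exact_def
proof (intro conjI allI ballI impI)
  have *: "\<exists>y\<in>A \<inter> B. x - y \<in> C" for x
    using inter_complementary[OF assms] by (auto simp: sum_is_full_def)
  then show "\<exists>y\<in>A \<inter> B. x - y \<in> C" for x .
  show "\<exists>a\<in>A. \<exists>b\<in>B. x - a - b \<in> C" for x
    using *[of x] sub(2)[THEN vec.subspace_0] by force
qed (use int in auto)

section \<open>Cohomology of a toric bundle, degree by degree\<close>

text \<open>
  Cochains can be constructed degree by degree, as long as the choice \<open>0\<close> works in almost all
  degrees.
\<close>
lemma poly_mapping_choice:
  fixes P :: "'a \<Rightarrow> 'b::zero \<Rightarrow> bool"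
  assumes "finite K" "\<And>m. \<exists>y. P m y" "\<And>m. m \<notin> K \<Longrightarrow> P m 0"
  shows "\<exists>s. \<forall>m. P m (Poly_Mapping.lookup s m)"
proof -
  obtain f where f: "\<And>m. P m (f m)" using assms(2) by metis
  define g where "g m = (if m \<in> K then f m else 0)" for m
  have "{m. g m \<noteq> 0} \<subseteq> K" by (auto simp: g_def)
  then have "finite {m. g m \<noteq> 0}" using assms(1) finite_subset by blast
  then have "Poly_Mapping.lookup (Abs_poly_mapping g) = g" by (rule lookup_Abs_poly_mapping)
  moreover have "P m (g m)" for m using f assms(3) by (simp add: g_def)
  ultimately show ?thesis by (intro exI[of _ "Abs_poly_mapping g"]) simp
qed

lemma subsets_of_3:
  "I \<subseteq> {..<3::nat} \<longleftrightarrow> I \<in> {{}, {2}, {1}, {1, 2}, {0}, {0, 2}, {0, 1}, {0, 1, 2}}"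
proof -
  have "{..<3::nat} = {0, 1, 2}" by auto
  then have "I \<subseteq> {..<3::nat} \<longleftrightarrow> I \<in> Pow {0, 1, 2}" by simp
  then show ?thesis
    by (simp only: Pow_insert Pow_empty image_insert image_empty Un_insert_left Un_empty_left)
qed

lemma coboundary_simps:
  fixes c :: "nat set \<Rightarrow> 'n::finite laurent"
  shows "coboundary c {} = 0" "coboundary c {0} = c {}" "coboundary c {1} = c {}" "coboundary c {2} = c {}"
    "coboundary c {0, 1} = c {1} - c {0}" "coboundary c {0, 2} = c {2} - c {0}"
    "coboundary c {1, 2} = c {2} - c {1}"
    "coboundary c {0, 1, 2} = c {1, 2} - c {0, 2} + c {0, 1}"
proof -
  have card: "card {j \<in> {0, 1 :: nat}. j < 0} = 0" "card {j \<in> {0, 1 :: nat}. j < 1} = 1"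
    "card {j \<in> {0, 2 :: nat}. j < 0} = 0" "card {j \<in> {0, 2 :: nat}. j < 2} = 1"
    "card {j \<in> {1, 2 :: nat}. j < 1} = 0" "card {j \<in> {1, 2 :: nat}. j < 2} = 1"
    "card {j \<in> {0, 1, 2 :: nat}. j < 0} = 0" "card {j \<in> {0, 1, 2 :: nat}. j < 1} = 1"
    "card {j \<in> {0, 1, 2 :: nat}. j < 2} = 2"
    by (simp_all add: Collect_conv_if2 insert_Collect[symmetric] card_insert_if
        Collect_disj_eq conj_disj_distribR cong: conj_cong)
  have del: "{0, 1 :: nat} - {0} = {1}" "{0, 1 :: nat} - {1} = {0}"
    "{0, 2 :: nat} - {0} = {2}" "{0, 2 :: nat} - {2} = {0}"
    "{1, 2 :: nat} - {1} = {2}" "{1, 2 :: nat} - {2} = {1}"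
    "{0, 1, 2 :: nat} - {0} = {1, 2}" "{0, 1, 2 :: nat} - {1} = {0, 2}" "{0, 1, 2 :: nat} - {2} = {0, 1}"
    by auto
  show "coboundary c {} = 0" "coboundary c {0} = c {}" "coboundary c {1} = c {}" "coboundary c {2} = c {}"
  proof -
    have "{j. j = k \<and> j < k} = {}" for k :: nat by auto
    note * = this
    have "coboundary c {k} = c {}" if "k < 3" for k using that by (simp add: coboundary_def *)
    then show "coboundary c {0} = c {}" "coboundary c {1} = c {}" "coboundary c {2} = c {}" by auto
  qed (simp add: coboundary_def)
  have sums: "(\<Sum>k\<in>{0, 1 :: nat}. f k) = f 0 + f 1" "(\<Sum>k\<in>{0, 2 :: nat}. f k) = f 0 + f 2"
    "(\<Sum>k\<in>{1, 2 :: nat}. f k) = f 1 + f 2" "(\<Sum>k\<in>{0, 1, 2 :: nat}. f k) = f 0 + f 1 + f 2"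
    for f :: "nat \<Rightarrow> 'n laurent" by (simp_all add: add.assoc)
  have le: "{0, 1 :: nat} \<subseteq> {..<3}" "{0, 2 :: nat} \<subseteq> {..<3}" "{1, 2 :: nat} \<subseteq> {..<3}"
    "{0, 1, 2 :: nat} \<subseteq> {..<3}"
    by simp_all
  show "coboundary c {0, 1} = c {1} - c {0}" "coboundary c {0, 2} = c {2} - c {0}"
    "coboundary c {1, 2} = c {2} - c {1}"
    "coboundary c {0, 1, 2} = c {1, 2} - c {0, 2} + c {0, 1}"
    unfolding coboundary_def sums card del if_P[OF le(1)] if_P[OF le(2)] if_P[OF le(3)] if_P[OF le(4)]
    by simp_all
qed

lemma coboundary_eq_iff:
  fixes c d :: "nat set \<Rightarrow> 'n::finite laurent"
  assumes "\<And>I. \<not> I \<subseteq> {..<3} \<Longrightarrow> d I = 0"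
  shows "coboundary c = d \<longleftrightarrow> d {} = 0 \<and> d {0} = c {} \<and> d {1} = c {} \<and> d {2} = c {} \<and>
    d {0, 1} = c {1} - c {0} \<and> d {0, 2} = c {2} - c {0} \<and> d {1, 2} = c {2} - c {1} \<and>
    d {0, 1, 2} = c {1, 2} - c {0, 2} + c {0, 1}" (is "_ \<longleftrightarrow> ?R")
proof
  assume "coboundary c = d"
  then show ?R using coboundary_simps[of c] by simp
next
  assume R: ?R
  show "coboundary c = d"
  proof
    fix I
    show "coboundary c I = d I"
    proof (cases "I \<subseteq> {..<3}")
      case False then show ?thesis using assms by (simp add: coboundary_def)
    next
      case True
      then show ?thesis unfolding subsets_of_3
        by (elim insertE emptyE) (use R coboundary_simps[of c] in simp_all)
    qed
  qed
qed

lemma coboundary_diff: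
  "coboundary (\<lambda>I. c I - c' I) I = coboundary c I - coboundary c' I"
  unfolding coboundary_def
  by (simp add: sum_subtractf[symmetric] del: sum_subtractf)
     (intro impI sum.cong refl, simp)

lemma coboundary_zero: "coboundary (\<lambda>I. 0) = (\<lambda>I. 0)"
  by (rule ext) (simp add: coboundary_def cong: if_cong)

lemma cohomology_vanishes_if_exact:
  assumes "coboundaries F p = cocycles F p"
    and diff: "\<And>I x y. I \<subseteq> {..<3} \<Longrightarrow> I \<noteq> {} \<Longrightarrow> x \<in> F I \<Longrightarrow> y \<in> F I \<Longrightarrow> x - y \<in> F I"
    and zero: "\<And>I. I \<subseteq> {..<3} \<Longrightarrow> I \<noteq> {} \<Longrightarrow> 0 \<in> F I"
  shows "cohomology_vanishes F p"
proof -
  have ne: "I \<noteq> {}" if "card I = Suc p" for I :: "nat set" using that by auto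
  have closed: "(\<lambda>I. c I - c' I) \<in> cocycles F p" if "c \<in> cocycles F p" "c' \<in> cocycles F p" for c c'
    using that diff ne unfolding cocycles_def cochains_def
    by (auto simp: coboundary_diff fun_eq_iff)
  have "(\<lambda>I. 0) \<in> cocycles F p"
    using zero ne by (auto simp: cocycles_def cochains_def coboundary_zero)
  then show ?thesis
    unfolding cohomology_vanishes_def cohomology_def quotient_def assms(1)
    using closed by auto
qed

lemma toric_sections:
  shows "s \<in> toric_bundle E {0} \<longleftrightarrow>
      (\<forall>m. Poly_Mapping.lookup s m \<in> E 1 (- pairing m (ray 1)) \<inter> E 2 (- pairing m (ray 2)))"
    and "s \<in> toric_bundle E {1} \<longleftrightarrow>
      (\<forall>m. Poly_Mapping.lookup s m \<in> E 0 (- pairing m (ray 0)) \<inter> E 2 (- pairing m (ray 2)))"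
    and "s \<in> toric_bundle E {2} \<longleftrightarrow>
      (\<forall>m. Poly_Mapping.lookup s m \<in> E 0 (- pairing m (ray 0)) \<inter> E 1 (- pairing m (ray 1)))"
    and "s \<in> toric_bundle E {0, 1} \<longleftrightarrow> (\<forall>m. Poly_Mapping.lookup s m \<in> E 2 (- pairing m (ray 2)))"
    and "s \<in> toric_bundle E {0, 2} \<longleftrightarrow> (\<forall>m. Poly_Mapping.lookup s m \<in> E 1 (- pairing m (ray 1)))"
    and "s \<in> toric_bundle E {1, 2} \<longleftrightarrow> (\<forall>m. Poly_Mapping.lookup s m \<in> E 0 (- pairing m (ray 0)))"
    and "s \<in> toric_bundle E {0, 1, 2}"
proof -
  have *: "{..<3} - {0} = {1, 2::nat}" "{..<3} - {1} = {0, 2::nat}" "{..<3} - {2} = {0, 1::nat}"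
    "{..<3} - {0, 1} = {2::nat}" "{..<3} - {0, 2} = {1::nat}" "{..<3} - {1, 2} = {0::nat}"
    "{..<3} - {0, 1, 2} = ({} :: nat set)"
    by auto
  show "s \<in> toric_bundle E {0} \<longleftrightarrow>
      (\<forall>m. Poly_Mapping.lookup s m \<in> E 1 (- pairing m (ray 1)) \<inter> E 2 (- pairing m (ray 2)))"
   "s \<in> toric_bundle E {1} \<longleftrightarrow>
      (\<forall>m. Poly_Mapping.lookup s m \<in> E 0 (- pairing m (ray 0)) \<inter> E 2 (- pairing m (ray 2)))"
   "s \<in> toric_bundle E {2} \<longleftrightarrow>
      (\<forall>m. Poly_Mapping.lookup s m \<in> E 0 (- pairing m (ray 0)) \<inter> E 1 (- pairing m (ray 1)))"
   "s \<in> toric_bundle E {0, 1} \<longleftrightarrow> (\<forall>m. Poly_Mapping.lookup s m \<in> E 2 (- pairing m (ray 2)))"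
   "s \<in> toric_bundle E {0, 2} \<longleftrightarrow> (\<forall>m. Poly_Mapping.lookup s m \<in> E 1 (- pairing m (ray 1)))"
   "s \<in> toric_bundle E {1, 2} \<longleftrightarrow> (\<forall>m. Poly_Mapping.lookup s m \<in> E 0 (- pairing m (ray 0)))"
   "s \<in> toric_bundle E {0, 1, 2}"
    unfolding toric_bundle_def mem_Collect_eq * by simp_all
qed

lemma cochains_iff:
  assumes "\<And>I. I \<subseteq> {..<3} \<and> card I = Suc p \<longleftrightarrow> I \<in> S"
  shows "c \<in> cochains F p \<longleftrightarrow> (\<forall>I\<in>S. c I \<in> F I) \<and> (\<forall>I. I \<notin> S \<longrightarrow> c I = 0)"
  unfolding cochains_def assms mem_Collect_eq by metis

lemma cochains_0_iff:
  "c \<in> cochains F 0 \<longleftrightarrow> (\<forall>I\<in>{{0}, {1}, {2}}. c I \<in> F I) \<and> (\<forall>I. I \<notin> {{0}, {1}, {2}} \<longrightarrow> c I = 0)"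
proof (rule cochains_iff, rule iffI)
  fix I :: "nat set" assume "I \<subseteq> {..<3} \<and> card I = Suc 0"
  then have "I \<in> {{}, {2}, {1}, {1, 2}, {0}, {0, 2}, {0, 1}, {0, 1, 2}}" "card I = Suc 0"
    by (simp_all only: subsets_of_3)
  then show "I \<in> {{0}, {1}, {2}}" by (elim insertE emptyE) simp_all
qed (elim insertE emptyE; simp)

lemma cochains_1_iff:
  "c \<in> cochains F 1 \<longleftrightarrow> (\<forall>I\<in>{{0, 1}, {0, 2}, {1, 2}}. c I \<in> F I) \<and>
     (\<forall>I. I \<notin> {{0, 1}, {0, 2}, {1, 2}} \<longrightarrow> c I = 0)"
proof (rule cochains_iff, rule iffI)
  fix I :: "nat set" assume "I \<subseteq> {..<3} \<and> card I = Suc 1"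
  then have "I \<in> {{}, {2}, {1}, {1, 2}, {0}, {0, 2}, {0, 1}, {0, 1, 2}}" "card I = Suc 1"
    by (simp_all only: subsets_of_3)
  then show "I \<in> {{0, 1}, {0, 2}, {1, 2}}" by (elim insertE emptyE) simp_all
qed (elim insertE emptyE; simp)

lemma cochains_2_iff:
  "c \<in> cochains F 2 \<longleftrightarrow> c {0, 1, 2} \<in> F {0, 1, 2} \<and> (\<forall>I. I \<noteq> {0, 1, 2} \<longrightarrow> c I = 0)"
proof -
  have "I \<subseteq> {..<3} \<and> card I = Suc 2 \<longleftrightarrow> I \<in> {{0, 1, 2}}" for I :: "nat set"
  proof (rule iffI)
    assume "I \<subseteq> {..<3} \<and> card I = Suc 2"
    then have "I \<in> {{}, {2}, {1}, {1, 2}, {0}, {0, 2}, {0, 1}, {0, 1, 2}}" "card I = Suc 2"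
      by (simp_all only: subsets_of_3)
    then show "I \<in> {{0, 1, 2}}" by (elim insertE emptyE) simp_all
  qed (elim insertE emptyE; simp)
  then have "c \<in> cochains F 2 \<longleftrightarrow> (\<forall>I\<in>{{0, 1, 2}}. c I \<in> F I) \<and> (\<forall>I. I \<notin> {{0, 1, 2}} \<longrightarrow> c I = 0)"
    by (rule cochains_iff)
  then show ?thesis by simp
qed

lemma cochains_ge_3:
  assumes "p \<ge> 3" shows "c \<in> cochains F p \<longleftrightarrow> c = (\<lambda>I. 0)"
proof -
  have "\<not> (I \<subseteq> {..<3} \<and> card I = Suc p)" for I :: "nat set"
    using card_mono[of "{..<3}" I] assms by auto
  then have "c \<in> cochains F p \<longleftrightarrow> (\<forall>I\<in>{}. c I \<in> F I) \<and> (\<forall>I. I \<notin> {} \<longrightarrow> c I = 0)"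
    by (intro cochains_iff) simp
  then show ?thesis by auto
qed

lemma coboundary_coboundary: "coboundary (coboundary c) = (\<lambda>I. 0)"
  by (subst coboundary_eq_iff) (simp_all add: coboundary_simps del: One_nat_def)

lemma pair_neq_triple: "{a, b} \<noteq> {0, 1, 2::nat}"
proof
  assume eq: "{a, b} = {0, 1, 2}"
  have "card {a, b} \<le> 2" by (simp add: card_insert_if)
  then show False unfolding eq by simp
qed

text \<open>
  In each cohomological degree the preimage of a cocycle is chosen character by character: the
  clauses of \<open>cech_exact\<close> provide, in this order, injectivity on \<open>0\<close>-cochains, surjectivity onto
  \<open>2\<close>-cochains and exactness in the middle.
\<close>
lemma cech_cohomology_vanishes:
  fixes E :: "'n::finite filtrations"
  assumes F: "\<And>I. I \<subseteq> {..<3} \<Longrightarrow> I \<noteq> {} \<Longrightarrow> F I = toric_bundle E I"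
    and sub: "\<And>i j. i < 3 \<Longrightarrow> vec.subspace (E i j)"
    and ex: "\<And>m. cech_exact (E 0 (- pairing m (ray 0))) (E 1 (- pairing m (ray 1)))
                (E 2 (- pairing m (ray 2)))"
  shows "cohomology_vanishes F p"
proof -
  have diff: "x - y \<in> F I" if "I \<subseteq> {..<3}" "I \<noteq> {}" "x \<in> F I" "y \<in> F I" for I x y
    using that(3,4) sub unfolding F[OF that(1,2)] toric_bundle_def
    by (auto simp: Poly_Mapping.lookup_minus intro: vec.subspace_diff)
  have zero: "0 \<in> F I" if "I \<subseteq> {..<3}" "I \<noteq> {}" for I
    using sub unfolding F[OF that] toric_bundle_def by (auto intro: vec.subspace_0)
  have FI: "F {0} = toric_bundle E {0}" "F {1} = toric_bundle E {1}" "F {2} = toric_bundle E {2}"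
    "F {0, 1} = toric_bundle E {0, 1}" "F {0, 2} = toric_bundle E {0, 2}"
    "F {1, 2} = toric_bundle E {1, 2}" "F {0, 1, 2} = toric_bundle E {0, 1, 2}"
    by (simp_all add: F)
  define V where "V i m = E i (- pairing m (ray i))" for i m
  have sV: "vec.subspace (V 0 m)" "vec.subspace (V 1 m)" "vec.subspace (V 2 m)" for m
    using sub by (simp_all add: V_def)
  note mem = toric_sections[where E = E, folded V_def]
  note ex = ex[folded V_def]
  have triv: "V 0 m \<inter> V 1 m \<inter> V 2 m \<subseteq> {0}" for m using ex by (auto simp: cech_exact_def)
  have surj: "\<exists>a\<in>V 0 m. \<exists>b\<in>V 1 m. x - a - b \<in> V 2 m" for m x
    using ex[of m] unfolding cech_exact_def by blast
  have mid: "\<exists>y\<in>V 0 m \<inter> V 1 m. a - y \<in> V 2 m" if "a \<in> V 0 m" "b \<in> V 1 m" "a - b \<in> V 2 m" for m a b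
    using ex[of m] that unfolding cech_exact_def by blast
  let ?l = Poly_Mapping.lookup
  consider "p = 0" | "p = 1" | "p = 2" | "p \<ge> 3" by linarith
  then have "coboundaries F p = cocycles F p"
  proof cases
    case 1
    have "c = (\<lambda>I. 0)" if c: "c \<in> cocycles F 0" for c
    proof -
      have mem_c: "c {0} \<in> F {0}" "c {1} \<in> F {1}" and 0: "\<And>I. I \<notin> {{0}, {1}, {2}} \<Longrightarrow> c I = 0"
        using c unfolding cocycles_def cochains_0_iff by auto
      have eq: "c {1} = c {0}" "c {2} = c {0}"
        using c coboundary_simps(5,6)[of c] unfolding cocycles_def by auto
      have "?l (c {0}) m = 0" for m
      proof -
        have "?l (c {0}) m \<in> V 0 m \<inter> V 1 m \<inter> V 2 m" using mem_c unfolding FI eq mem by blast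
        then show ?thesis using triv by blast
      qed
      then have "c {0} = 0" by (simp add: poly_mapping_eqI)
      then show ?thesis using 0 eq by (metis insertE singletonD)
    qed
    moreover have "(\<lambda>I. 0) \<in> cocycles F 0"
      unfolding cocycles_def cochains_0_iff
      by (auto simp: coboundary_zero intro!: zero)
    ultimately have "cocycles F 0 = {\<lambda>I. 0}" by blast
    then show ?thesis using 1 by simp
  next
    case 2
    have sup: "coboundary c \<in> cocycles F 1" if c: "c \<in> cochains F 0" for c
    proof -
      have mem_c: "c {0} \<in> F {0}" "c {1} \<in> F {1}" "c {2} \<in> F {2}"
        and 0: "\<And>I. I \<notin> {{0}, {1}, {2}} \<Longrightarrow> c I = 0"
        using c unfolding cochains_0_iff by auto
      have "?l (c {0}) m \<in> V 1 m \<inter> V 2 m" "?l (c {1}) m \<in> V 0 m \<inter> V 2 m"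
        "?l (c {2}) m \<in> V 0 m \<inter> V 1 m" for m
        using mem_c unfolding FI mem by blast+
      then have "coboundary c {0, 1} \<in> F {0, 1}" "coboundary c {0, 2} \<in> F {0, 2}"
        "coboundary c {1, 2} \<in> F {1, 2}"
        unfolding coboundary_simps FI mem Poly_Mapping.lookup_minus using vec.subspace_diff[OF sV(1)]
          vec.subspace_diff[OF sV(2)] vec.subspace_diff[OF sV(3)] by blast+
      then have "\<forall>I\<in>{{0, 1}, {0, 2}, {1, 2}}. coboundary c I \<in> F I" by blast
      moreover have "coboundary c I = 0" if "I \<notin> {{0, 1}, {0, 2}, {1, 2}}" for I
      proof (cases "I \<subseteq> {..<3}")
        case False then show ?thesis by (simp add: coboundary_def)
      next
        case True
        have z: "c {} = 0" "c {1, 2} = 0" "c {0, 2} = 0" "c {0, 1} = 0"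
          by (rule 0; simp add: doubleton_eq_iff)+
        from True have "I \<in> {{}, {2}, {1}, {0}, {0, 1, 2}}" using that unfolding subsets_of_3 by simp
        then show ?thesis by (elim insertE emptyE) (simp_all only: coboundary_simps z, simp_all)
      qed
      ultimately show ?thesis unfolding cocycles_def cochains_1_iff
        by (simp add: coboundary_coboundary)
    qed
    have "c \<in> coboundary ` cochains F 0" if c: "c \<in> cocycles F 1" for c
    proof -
      have mem_c: "c {0, 1} \<in> F {0, 1}" "c {0, 2} \<in> F {0, 2}" "c {1, 2} \<in> F {1, 2}"
        and 0: "\<And>I. I \<notin> {{0, 1}, {0, 2}, {1, 2}} \<Longrightarrow> c I = 0"
        using c unfolding cocycles_def cochains_1_iff by auto
      have cyc: "c {1, 2} - c {0, 2} + c {0, 1} = 0"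
        using c coboundary_simps(8)[of c] unfolding cocycles_def by auto
      have in_V: "?l (c {0, 1}) m \<in> V 2 m" "?l (c {0, 2}) m \<in> V 1 m" "?l (c {1, 2}) m \<in> V 0 m" for m
        using mem_c unfolding FI mem by blast+
      have diff_l: "?l (c {1, 2}) m - ?l (c {0, 2}) m = - ?l (c {0, 1}) m" for m
        using arg_cong[OF cyc, of "\<lambda>s. ?l s m"]
        by (simp add: Poly_Mapping.lookup_minus Poly_Mapping.lookup_add eq_neg_iff_add_eq_0)
      \<comment> \<open>The component over \<open>U\<^sub>2\<close> determines the other two, whose remaining membership
        conditions are met because of the cocycle identity.\<close>
      have "\<exists>s. \<forall>m. ?l s m \<in> V 0 m \<inter> V 1 m \<and> ?l (c {1, 2}) m - ?l s m \<in> V 2 m"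
      proof (rule poly_mapping_choice[OF finite_keys[of "c {1, 2}"]])
        show "\<exists>y. y \<in> V 0 m \<inter> V 1 m \<and> ?l (c {1, 2}) m - y \<in> V 2 m" for m
          using mid[OF in_V(3) in_V(2)] vec.subspace_neg[OF sV(3) in_V(1)] unfolding diff_l by blast
        show "0 \<in> V 0 m \<inter> V 1 m \<and> ?l (c {1, 2}) m - 0 \<in> V 2 m" if "m \<notin> Poly_Mapping.keys (c {1, 2})" for m
          using that sV[THEN vec.subspace_0] by (simp add: in_keys_iff)
      qed
      then obtain s where s: "\<And>m. ?l s m \<in> V 0 m \<inter> V 1 m" "\<And>m. ?l (c {1, 2}) m - ?l s m \<in> V 2 m"
        by blast
      define b :: "nat set \<Rightarrow> 'n laurent" where
        "b I = (if I = {2} then s else if I = {1} then s - c {1, 2} else if I = {0} then s - c {0, 2}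
                else 0)" for I
      have b: "b {0} = s - c {0, 2}" "b {1} = s - c {1, 2}" "b {2} = s" "b {} = 0"
        "b {0, 1} = 0" "b {0, 2} = 0" "b {1, 2} = 0"
        by (simp_all add: b_def)
      have 1: "?l s m - ?l (c {1, 2}) m \<in> V 2 m" for m
        using vec.subspace_neg[OF sV(3) s(2)[of m]] by simp
      have 2: "?l s m - ?l (c {0, 2}) m \<in> V 2 m" for m
      proof -
        have "?l s m - ?l (c {0, 2}) m
            = (?l s m - ?l (c {1, 2}) m) + (?l (c {1, 2}) m - ?l (c {0, 2}) m)" by simp
        also have "\<dots> = (?l s m - ?l (c {1, 2}) m) - ?l (c {0, 1}) m" unfolding diff_l by simp
        finally have eq: "?l s m - ?l (c {0, 2}) m = (?l s m - ?l (c {1, 2}) m) - ?l (c {0, 1}) m" .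
        show ?thesis unfolding eq by (rule vec.subspace_diff[OF sV(3) 1 in_V(1)])
      qed
      have "b {0} \<in> F {0}" "b {1} \<in> F {1}" "b {2} \<in> F {2}"
        unfolding b FI mem Poly_Mapping.lookup_minus
        using 1 2 s in_V vec.subspace_diff[OF sV(1)] vec.subspace_diff[OF sV(2)] by simp_all
      moreover have "b I = 0" if "I \<notin> {{0}, {1}, {2}}" for I using that by (simp add: b_def)
      ultimately have "b \<in> cochains F 0" unfolding cochains_0_iff by simp
      moreover have "coboundary b = c"
      proof (subst coboundary_eq_iff)
        show "c I = 0" if "\<not> I \<subseteq> {..<3}" for I
          using that c unfolding cocycles_def cochains_def by auto
        have "{0, 1, 2::nat} \<notin> {{0, 1}, {0, 2}, {1, 2}}"
          using pair_neq_triple by (metis empty_iff insertE)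
        then have "c {0, 1, 2} = 0" by (rule 0)
        moreover have "c {} = 0" "c {0} = 0" "c {1} = 0" "c {2} = 0" by (rule 0; simp)+
        moreover have "c {0, 1} = c {0, 2} - c {1, 2}" using cyc by (simp add: algebra_simps)
        ultimately show "c {} = 0 \<and> c {0} = b {} \<and> c {1} = b {} \<and> c {2} = b {} \<and>
           c {0, 1} = b {1} - b {0} \<and> c {0, 2} = b {2} - b {0} \<and> c {1, 2} = b {2} - b {1} \<and>
           c {0, 1, 2} = b {1, 2} - b {0, 2} + b {0, 1}"
          unfolding b by simp
      qed
      ultimately show ?thesis by blast
    qed
    then have "coboundary ` cochains F 0 = cocycles F 1" using sup by blast
    then show ?thesis using 2 by simp
  next
    case 3
    have "coboundary c \<in> cocycles F 2" if c: "c \<in> cochains F 1" for c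
    proof -
      have "c {} = 0" "c {0} = 0" "c {1} = 0" "c {2} = 0"
        using c unfolding cochains_1_iff by auto
      note z = this
      have "coboundary c {0, 1, 2} \<in> F {0, 1, 2}" unfolding FI by (rule toric_sections(7))
      moreover have "coboundary c I = 0" if "I \<noteq> {0, 1, 2}" for I
      proof (cases "I \<subseteq> {..<3}")
        case False then show ?thesis by (simp add: coboundary_def)
      next
        case True
        then have "I \<in> {{}, {2}, {1}, {1, 2}, {0}, {0, 2}, {0, 1}}"
          using that unfolding subsets_of_3 by simp
        then show ?thesis by (elim insertE emptyE) (simp_all only: coboundary_simps z, simp_all)
      qed
      ultimately show ?thesis unfolding cocycles_def cochains_2_iff
        by (simp add: coboundary_coboundary)
    qed
    moreover have "c \<in> coboundary ` cochains F 1" if c: "c \<in> cocycles F 2" for c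
    proof -
      have 0: "\<And>I. I \<noteq> {0, 1, 2} \<Longrightarrow> c I = 0"
        using c unfolding cocycles_def cochains_2_iff by auto
      let ?s = "c {0, 1, 2}"
      have "\<exists>u. \<forall>m. ?l u m \<in> V 0 m \<and> (\<exists>b\<in>V 1 m. ?l ?s m - ?l u m - b \<in> V 2 m)"
      proof (rule poly_mapping_choice[OF finite_keys[of ?s]])
        show "\<exists>y. y \<in> V 0 m \<and> (\<exists>b\<in>V 1 m. ?l ?s m - y - b \<in> V 2 m)" for m
          using surj[of m] by blast
        show "0 \<in> V 0 m \<and> (\<exists>b\<in>V 1 m. ?l ?s m - 0 - b \<in> V 2 m)" if "m \<notin> Poly_Mapping.keys ?s" for m
          using that sV[THEN vec.subspace_0, of m] by (intro conjI bexI[of _ 0]) (simp_all add: in_keys_iff)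
      qed
      then obtain u where u: "\<And>m. ?l u m \<in> V 0 m" "\<And>m. \<exists>b\<in>V 1 m. ?l (?s - u) m - b \<in> V 2 m"
        unfolding Poly_Mapping.lookup_minus by blast
      have "\<exists>v. \<forall>m. ?l v m \<in> V 1 m \<and> ?l (?s - u) m - ?l v m \<in> V 2 m"
      proof (rule poly_mapping_choice[OF finite_keys[of "?s - u"]])
        show "\<exists>y. y \<in> V 1 m \<and> ?l (?s - u) m - y \<in> V 2 m" for m using u(2) by blast
        show "0 \<in> V 1 m \<and> ?l (?s - u) m - 0 \<in> V 2 m" if "m \<notin> Poly_Mapping.keys (?s - u)" for m
          using that sV[THEN vec.subspace_0] by (simp add: in_keys_iff)
      qed
      then obtain v where v: "\<And>m. ?l v m \<in> V 1 m" "\<And>m. ?l (?s - u) m - ?l v m \<in> V 2 m"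
        by blast
      define b :: "nat set \<Rightarrow> 'n laurent" where
        "b I = (if I = {1, 2} then u else if I = {0, 2} then - v else if I = {0, 1} then ?s - u - v
                else 0)" for I
      have b: "b {0, 1} = ?s - u - v" "b {0, 2} = - v" "b {1, 2} = u" "b {} = 0"
        "b {0} = 0" "b {1} = 0" "b {2} = 0"
        by (auto simp: b_def doubleton_eq_iff)
      have "b {0, 1} \<in> F {0, 1}" "b {0, 2} \<in> F {0, 2}" "b {1, 2} \<in> F {1, 2}"
        unfolding b FI mem
        using u v vec.subspace_neg[OF sV(2)] by (simp_all add: Poly_Mapping.lookup_minus)
      moreover have "b I = 0" if "I \<notin> {{0, 1}, {0, 2}, {1, 2}}" for I using that by (simp add: b_def)
      ultimately have "b \<in> cochains F 1" unfolding cochains_1_iff by simp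
      moreover have "coboundary b = c"
      proof (subst coboundary_eq_iff)
        show "c I = 0" if "\<not> I \<subseteq> {..<3}" for I
          using that c unfolding cocycles_def cochains_def by auto
        have "c {} = 0" "c {0} = 0" "c {1} = 0" "c {2} = 0" by (rule 0; simp)+
        moreover have "c {0, 1} = 0" "c {0, 2} = 0" "c {1, 2} = 0" by (rule 0, rule pair_neq_triple)+
        ultimately show "c {} = 0 \<and> c {0} = b {} \<and> c {1} = b {} \<and> c {2} = b {} \<and>
           c {0, 1} = b {1} - b {0} \<and> c {0, 2} = b {2} - b {0} \<and> c {1, 2} = b {2} - b {1} \<and>
           c {0, 1, 2} = b {1, 2} - b {0, 2} + b {0, 1}"
          unfolding b by simp
      qed
      ultimately show ?thesis by blast
    qed
    ultimately have "coboundary ` cochains F 1 = cocycles F 2" by blast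
    then show ?thesis using 3 by (simp add: numeral_2_eq_2)
  next
    case 4
    then obtain q where q: "p = Suc q" "q \<ge> 2" by (cases p) auto
    have const: "coboundary c = (\<lambda>I. 0)" if c: "c \<in> cochains F q" for c
    proof -
      have "c = (\<lambda>I. 0) \<or> (\<forall>I. I \<noteq> {0, 1, 2} \<longrightarrow> c I = 0)"
        using c q cochains_ge_3[of q c F] cochains_2_iff[of c F] by (cases "q = 2") auto
      then have z: "c I = 0" if "I \<noteq> {0, 1, 2}" for I using that by (elim disjE) simp_all
      have "c {0, 1} = 0" "c {0, 2} = 0" "c {1, 2} = 0" by (rule z, rule pair_neq_triple)+
      moreover have "c {} = 0" "c {0} = 0" "c {1} = 0" "c {2} = 0" by (rule z; simp)+
      ultimately show ?thesis by (subst coboundary_eq_iff) simp_all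
    qed
    have zero_mem: "(\<lambda>I. 0) \<in> cochains F q"
    proof -
      have "0 \<in> F I" if "I \<subseteq> {..<3} \<and> card I = Suc q" for I
      proof (rule zero)
        show "I \<noteq> {}" using that by (metis card.empty nat.distinct(1))
      qed (use that in simp)
      then show ?thesis unfolding cochains_def by simp
    qed
    have "coboundary ` cochains F q = (\<lambda>c I. 0) ` cochains F q" by (rule image_cong[OF refl const])
    also have "\<dots> = {\<lambda>I. 0}" by (rule image_constant[OF zero_mem])
    finally have im: "coboundary ` cochains F q = {\<lambda>I. 0}" .
    have "cochains F p = {\<lambda>I. 0}" by (rule set_eqI) (simp add: cochains_ge_3[OF 4])
    then have "cocycles F p = {\<lambda>I. 0}" by (simp add: cocycles_def coboundary_zero cong: conj_cong)
    then show ?thesis using im unfolding q by simp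
  qed
  then show ?thesis using diff zero by (rule cohomology_vanishes_if_exact)
qed

section \<open>Flags in general position\<close>

text \<open>
  The tuple of subspaces admits no nontrivial solution of a system of linear equations with scalar
  coefficients. Both conditions of general position are of this form: with one equation, that the
  subspaces are independent; with the two equations \<open>v\<^sub>0 = v\<^sub>1\<close> and \<open>v\<^sub>0 = v\<^sub>2\<close>, that they meet in
  \<open>0\<close>. This lets one determinant construction serve both.
\<close>
definition no_relation :: "('s \<Rightarrow> nat \<Rightarrow> complex) \<Rightarrow> (nat \<Rightarrow> (complex ^ 'n::finite) set) \<Rightarrow> bool" where
  "no_relation \<epsilon> V \<longleftrightarrow> (\<forall>v. (\<forall>i<3. v i \<in> V i) \<longrightarrow> (\<forall>s. (\<Sum>i<3. \<epsilon> s i *s v i) = 0) \<longrightarrow> (\<forall>i<3. v i = 0))"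

definition sum_coeff :: "unit \<Rightarrow> nat \<Rightarrow> complex" where
  "sum_coeff s i = 1"

definition diff_coeff :: "bool \<Rightarrow> nat \<Rightarrow> complex" where
  "diff_coeff s i = (if i = 0 then 1 else if (i = 1) = s then -1 else 0)"

definition flag_step :: "(nat \<Rightarrow> (complex ^ 'n::finite) set) \<Rightarrow> int \<Rightarrow> (complex ^ 'n) set" where
  "flag_step W k = (if k \<le> 0 then {0} else if k \<ge> int CARD('n) then UNIV else W (nat k))"

text \<open>Extensional functions, so that there are only finitely many of them.\<close>
definition step_dims :: "nat \<Rightarrow> (nat \<Rightarrow> nat set) \<Rightarrow> (nat \<Rightarrow> nat) set" where
  "step_dims n K = (\<Pi>\<^sub>E i\<in>{..<3}. insert 0 (insert n (K i)))"

definition general_position :: "(nat \<Rightarrow> nat set) \<Rightarrow> 'n::finite flag_triple \<Rightarrow> bool" where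
  "general_position K W \<longleftrightarrow> (\<forall>k\<in>step_dims CARD('n) K.
     ((\<Sum>i<3. k i) = CARD('n) \<longrightarrow> no_relation sum_coeff (\<lambda>i. flag_step (W i) (int (k i)))) \<and>
     ((\<Sum>i<3. k i) = 2 * CARD('n) \<longrightarrow> no_relation diff_coeff (\<lambda>i. flag_step (W i) (int (k i)))))"

lemma sum_three_indices:
  fixes f :: "nat \<Rightarrow> 'a::comm_monoid_add"
  assumes "{i, j, k} = {..<3::nat}"
  shows "(\<Sum>i<3. f i) = f i + f j + f k"
  unfolding assms[symmetric] using three_indices_distinct[OF assms] by (simp add: add.assoc)

lemma third_index:
  assumes "i < 3" "j < 3" "i \<noteq> (j::nat)"
  obtains k where "{i, j, k} = {..<3}"
proof
  have "i \<in> {0, 1, 2}" "j \<in> {0, 1, 2}" using assms by auto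
  moreover have "{..<3::nat} = {0, 1, 2}" by auto
  ultimately show "{i, j, 3 - i - j} = {..<3}"
    using assms(3) by (elim insertE emptyE) (simp_all add: insert_commute)
qed

lemma all_less_3: "(\<forall>i<3. P i) \<longleftrightarrow> P 0 \<and> P 1 \<and> P (2::nat)"
proof -
  have "{..<3::nat} = {0, 1, 2}" by auto
  then have "(\<forall>i\<in>{..<3}. P i) \<longleftrightarrow> P 0 \<and> P 1 \<and> P (2::nat)" by simp
  then show ?thesis unfolding Ball_def lessThan_iff .
qed

lemma sum_less_3: "(\<Sum>i<3. f i) = f 0 + f 1 + f (2::nat)" for f :: "nat \<Rightarrow> 'a::comm_monoid_add"
  by (rule sum_three_indices) auto

lemma no_relation_sumD:
  assumes "no_relation sum_coeff V" "{i, j, k} = {..<3::nat}"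
    "a \<in> V i" "b \<in> V j" "c \<in> V k" "a + b + c = 0"
  shows "a = 0" "b = 0" "c = 0"
proof -
  note d = three_indices_distinct[OF assms(2)]
  define v where "v l = (if l = i then a else if l = j then b else c)" for l
  have v: "v i = a" "v j = b" "v k = c" using d by (auto simp: v_def)
  have all: "(\<forall>l<3. P l) \<longleftrightarrow> P i \<and> P j \<and> P k" for P
  proof -
    have "(\<forall>l<3. P l) \<longleftrightarrow> (\<forall>l\<in>{i, j, k}. P l)" unfolding assms(2) by auto
    then show ?thesis by simp
  qed
  have "(\<Sum>l<3. sum_coeff s l *s v l) = 0" for s
    unfolding sum_three_indices[OF assms(2)] v using assms(6) by (simp add: sum_coeff_def)
  moreover have "\<forall>l<3. v l \<in> V l" unfolding all v using assms(3,4,5) by simp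
  ultimately have "\<forall>l<3. v l = 0"
    using assms(1) unfolding no_relation_def by blast
  then show "a = 0" "b = 0" "c = 0" using v all by auto
qed

lemma no_relation_diffD:
  assumes "no_relation diff_coeff V" "\<forall>i<3. x \<in> V i"
  shows "x = 0"
proof -
  have "(\<Sum>i<3. diff_coeff s i *s x) = 0" for s
    unfolding sum_less_3 by (simp add: diff_coeff_def)
  then have "\<forall>i<3::nat. x = 0"
    using assms(1)[unfolded no_relation_def, THEN spec[of _ "\<lambda>_. x"]] assms(2) by blast
  from this[rule_format, of 0] show ?thesis by simp
qed

lemma flag_step_full:
  assumes "int CARD('n) \<le> k" shows "flag_step W k = (UNIV :: (complex ^ 'n::finite) set)"
proof -
  have "0 < int CARD('n)" by simp
  then have "\<not> k \<le> 0" using assms by linarith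
  then show ?thesis using assms by (simp add: flag_step_def)
qed

text \<open>Only for indices in range is the index of a step its dimension.\<close>
lemma flag_step_in_range:
  assumes "W \<in> flags K" "K \<subseteq> {1..<CARD('n::finite)}" "k \<in> insert 0 (insert CARD('n) K)"
  shows "vec.subspace (flag_step W (int k) :: (complex ^ 'n) set)"
    and "vec.dim (flag_step W (int k) :: (complex ^ 'n) set) = k"
proof -
  have n: "CARD('n) > 0" by simp
  consider "k = 0" | "k = CARD('n)" | "k \<in> K" "0 < k" "k < CARD('n)" using assms(2,3) by auto
  then have "vec.subspace (flag_step W (int k)) \<and> vec.dim (flag_step W (int k)) = k"
  proof cases
    case 1
    then show ?thesis by (simp add: flag_step_def vec.subspace_single_0)
  next
    case 2
    then have "flag_step W (int k) = UNIV" using n by (simp add: flag_step_def)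
    then show ?thesis using 2 by (simp only: vec_dim_card vec.subspace_UNIV)
  next
    case 3
    then show ?thesis using assms(1) by (simp add: flag_step_def flags_def)
  qed
  then show "vec.subspace (flag_step W (int k))" "vec.dim (flag_step W (int k)) = k" by auto
qed

locale general_flags =
  fixes K :: "nat \<Rightarrow> nat set" and W :: "'n::finite flag_triple"
  assumes proper: "\<And>i. i < 3 \<Longrightarrow> K i \<subseteq> {1..<CARD('n)}"
    and flags: "W \<in> flag_triples K"
    and general: "general_position K W"
begin

abbreviation "V e i \<equiv> flag_step (W i) (e i)"

text \<open>
  A flag need not have steps of all dimensions. The indices that are allowed are the dimensions of
  steps up to multiples of \<open>n\<close>, so that they stay allowed when shifted by \<open>n\<close>.
\<close>
definition admissible :: "(nat \<Rightarrow> int) \<Rightarrow> bool" where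
  "admissible e \<longleftrightarrow> (\<forall>i<3. e i mod int CARD('n) \<in> int ` insert 0 (K i))"

definition in_range :: "(nat \<Rightarrow> int) \<Rightarrow> bool" where
  "in_range e \<longleftrightarrow> (\<forall>i<3. 0 \<le> e i \<and> e i \<le> int CARD('n))"

lemma flags_i: "i < 3 \<Longrightarrow> W i \<in> flags (K i)"
  using flags unfolding flag_triples_def by auto

lemma admissible_dims:
  assumes "admissible e" "i < 3" "0 \<le> e i" "e i \<le> int CARD('n)"
  obtains k where "e i = int k" "k \<in> insert 0 (insert CARD('n) (K i))"
proof (cases "e i = int CARD('n)")
  case False
  then have "e i mod int CARD('n) = e i" using assms by simp
  then have "e i \<in> int ` insert 0 (K i)" using assms(1,2) unfolding admissible_def by metis
  then show thesis using that by blast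
qed (use that in blast)

lemma subspace_V:
  assumes "admissible e" "i < 3" shows "vec.subspace (V e i)"
proof (cases "0 \<le> e i \<and> e i \<le> int CARD('n)")
  case True
  then obtain k where "e i = int k" "k \<in> insert 0 (insert CARD('n) (K i))"
    using admissible_dims[OF assms] by blast
  then show ?thesis using flag_step_in_range(1)[OF flags_i proper] assms(2) by simp
next
  case False
  then show ?thesis by (auto simp: flag_step_def vec.subspace_single_0)
qed

lemma in_range_dims:
  assumes "admissible e" "in_range e"
  obtains k where "k \<in> step_dims CARD('n) K" "\<And>i. i < 3 \<Longrightarrow> e i = int (k i)"
    "\<And>i. i < 3 \<Longrightarrow> vec.dim (V e i) = k i"
proof
  let ?k = "\<lambda>i\<in>{..<3}. nat (e i)"
  have *: "e i = int (nat (e i)) \<and> nat (e i) \<in> insert 0 (insert CARD('n) (K i))" if "i < 3" for i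
    using admissible_dims[OF assms(1) that] assms(2) that unfolding in_range_def by fastforce
  then show "?k \<in> step_dims CARD('n) K" unfolding step_dims_def by auto
  show "e i = int (?k i)" if "i < 3" for i using * that by simp
  show "vec.dim (V e i) = ?k i" if "i < 3" for i
    using flag_step_in_range(2)[OF flags_i[OF that] proper[OF that]] * that
    by (metis lessThan_iff restrict_apply')
qed

lemma independent_steps:
  assumes "admissible e" "in_range e" "(\<Sum>i<3. e i) = int CARD('n)"
  shows "cech_exact (V e 0) (V e 1) (V e 2)"
    and "\<And>i j. i < 3 \<Longrightarrow> j < 3 \<Longrightarrow> i \<noteq> j \<Longrightarrow> V e i \<inter> V e j \<subseteq> {0}"
proof -
  obtain k where k: "k \<in> step_dims CARD('n) K" "\<And>i. i < 3 \<Longrightarrow> e i = int (k i)"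
    and dim: "\<And>i. i < 3 \<Longrightarrow> vec.dim (V e i) = k i"
    using in_range_dims assms by blast
  have "int (\<Sum>i<3. k i) = int CARD('n)" using assms(3) k(2) by simp
  then have sum: "(\<Sum>i<3. k i) = CARD('n)" by linarith
  then have "no_relation sum_coeff (\<lambda>i. flag_step (W i) (int (k i)))"
    using general k(1) unfolding general_position_def by blast
  then have rel: "no_relation sum_coeff (V e)" unfolding no_relation_def using k(2) by simp
  have ijk: "{0, 1, 2} = {..<3::nat}" by auto
  show "cech_exact (V e 0) (V e 1) (V e 2)"
    using no_relation_sumD[OF rel ijk] subspace_V[OF assms(1)] dim sum unfolding sum_less_3
    by (intro cech_exact_independent) (auto simp del: One_nat_def)
  fix i j :: nat assume ij: "i < 3" "j < 3" "i \<noteq> j"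
  then obtain l where l: "{i, j, l} = {..<3}" by (rule third_index)
  then have "l < 3" by blast
  then have "0 \<in> V e l" using subspace_V[OF assms(1)] vec.subspace_0 by blast
  show "V e i \<inter> V e j \<subseteq> {0}"
  proof
    fix x assume x: "x \<in> V e i \<inter> V e j"
    then have "- x \<in> V e j" using subspace_V[OF assms(1) ij(2)] vec.subspace_neg by blast
    then show "x \<in> {0}" using no_relation_sumD(1)[OF rel l, of x "- x" 0] x \<open>0 \<in> V e l\<close> by simp
  qed
qed

lemma transversal_steps:
  assumes "admissible e" "in_range e" "(\<Sum>i<3. e i) = 2 * int CARD('n)"
  shows "cech_exact (V e 0) (V e 1) (V e 2)"
    and "\<And>i j. i < 3 \<Longrightarrow> j < 3 \<Longrightarrow> i \<noteq> j \<Longrightarrow> sum_is_full (V e i) (V e j)"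
proof -
  obtain k where k: "k \<in> step_dims CARD('n) K" "\<And>i. i < 3 \<Longrightarrow> e i = int (k i)"
    and dim: "\<And>i. i < 3 \<Longrightarrow> vec.dim (V e i) = k i"
    using in_range_dims assms by blast
  have "int (\<Sum>i<3. k i) = 2 * int CARD('n)" using assms(3) k(2) by simp
  then have sum: "(\<Sum>i<3. k i) = 2 * CARD('n)" by linarith
  then have "no_relation diff_coeff (\<lambda>i. flag_step (W i) (int (k i)))"
    using general k(1) unfolding general_position_def by blast
  then have rel: "no_relation diff_coeff (V e)" unfolding no_relation_def using k(2) by simp
  have int: "V e i \<inter> V e j \<inter> V e l \<subseteq> {0}" if "{i, j, l} = {..<3}" for i j l
  proof
    fix x assume "x \<in> V e i \<inter> V e j \<inter> V e l"
    then have "\<forall>m\<in>{i, j, l}. x \<in> V e m" by simp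
    then show "x \<in> {0}" using no_relation_diffD[OF rel] unfolding that by simp
  qed
  have ijk: "{0, 1, 2} = {..<3::nat}" by auto
  show "cech_exact (V e 0) (V e 1) (V e 2)"
    using subspace_V[OF assms(1)] dim sum int[OF ijk] unfolding sum_less_3
    by (intro cech_exact_transversal) (auto simp del: One_nat_def)
  fix i j :: nat assume ij: "i < 3" "j < 3" "i \<noteq> j"
  then obtain l where l: "{i, j, l} = {..<3}" by (rule third_index)
  then have l3: "l < 3" by blast
  have l': "{i, l, j} = {..<3}" using l by (simp add: insert_commute)
  have "vec.dim (V e i) + vec.dim (V e l) + vec.dim (V e j) = 2 * CARD('n)"
    using sum dim ij l3 unfolding sum_three_indices[OF l'] by simp
  then have "sum_is_full (V e i \<inter> V e l) (V e j)"
    using subspace_V[OF assms(1)] ij l3 int[OF l'] by (intro inter_complementary) auto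
  then show "sum_is_full (V e i) (V e j)" by (rule sum_is_full_mono) auto
qed

lemma admissible_shift:
  assumes "admissible e" "d = int CARD('n) \<or> d = - int CARD('n)"
  shows "admissible (e(i := e i + d))"
  using assms unfolding admissible_def by auto

text \<open>
  If the index at \<open>i\<close> is negative, then \<open>V\<^sub>i = 0\<close> and the other two subspaces have to fill \<open>E\<close>.
  Unless one of them is already \<open>E\<close>, raising this index by \<open>n\<close> gives a triple in range with sum
  \<open>2 n\<close> in which the other two are unchanged, and there any two of the subspaces fill \<open>E\<close>.
\<close>
lemma exact_sum_n:
  assumes adm: "admissible e" and sum: "(\<Sum>i<3. e i) = int CARD('n)"
  shows "cech_exact (V e 0) (V e 1) (V e 2)"
proof (cases "\<forall>i<3. 0 \<le> e i")
  case True
  then have "0 \<le> e 0" "0 \<le> e 1" "0 \<le> e 2" by auto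
  then have "e i \<le> int CARD('n)" if "i < 3" for i
  proof -
    have "i = 0 \<or> i = 1 \<or> i = 2" using that by auto
    then show ?thesis using sum \<open>0 \<le> e 0\<close> \<open>0 \<le> e 1\<close> \<open>0 \<le> e 2\<close> unfolding sum_less_3 by (elim disjE) auto
  qed
  then show ?thesis using True independent_steps(1)[OF adm _ sum] by (simp add: in_range_def)
next
  case False
  then obtain i where i: "i < 3" "e i < 0" by auto
  obtain j where j: "j < 3" "i \<noteq> j"
  proof -
    show thesis using that[of 0] that[of 1] by (cases "i = 0") auto
  qed
  obtain k where ijk: "{i, j, k} = {..<3}" using third_index[OF i(1) j] by blast
  then have k: "k < 3" by blast
  note d = three_indices_distinct[OF ijk]
  have s: "e i + e j + e k = int CARD('n)" using sum unfolding sum_three_indices[OF ijk] .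
  have "sum_is_full (V e j) (V e k)"
  proof (cases "e j \<ge> int CARD('n) \<or> e k \<ge> int CARD('n)")
    case True
    then have "V e j = UNIV \<or> V e k = UNIV" using flag_step_full by blast
    then show ?thesis using sum_is_full_UNIV subspace_V[OF adm] j k by metis
  next
    case False
    let ?f = "e(i := e i + int CARD('n))"
    have f: "?f i = e i + int CARD('n)" "?f j = e j" "?f k = e k" using d by auto
    have "\<forall>l\<in>{i, j, k}. 0 \<le> ?f l \<and> ?f l \<le> int CARD('n)"
      using f s i(2) False by simp
    then have "in_range ?f" unfolding ijk in_range_def by blast
    moreover have "(\<Sum>l<3. ?f l) = 2 * int CARD('n)" unfolding sum_three_indices[OF ijk] f using s by simp
    ultimately have "sum_is_full (V ?f j) (V ?f k)"
      using transversal_steps(2)[OF admissible_shift[OF adm]] j k d by blast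
    then show ?thesis unfolding f .
  qed
  moreover have "V e i = {0}" using i by (simp add: flag_step_def)
  ultimately have "cech_exact (V e i) (V e j) (V e k)"
    using subspace_V[OF adm] j k by (intro cech_exact_zero) auto
  then show ?thesis using subspace_V[OF adm] by (intro cech_exact_permute[OF _ ijk]) auto
qed

text \<open>
  Dually, if the index at \<open>i\<close> exceeds \<open>n\<close>, then \<open>V\<^sub>i = E\<close> and the other two subspaces have to meet
  in \<open>0\<close>. Unless one of them is already \<open>0\<close>, this is read off from the triple with this index
  lowered by \<open>n\<close>.
\<close>
lemma exact_sum_2n:
  assumes adm: "admissible e" and sum: "(\<Sum>i<3. e i) = 2 * int CARD('n)"
  shows "cech_exact (V e 0) (V e 1) (V e 2)"
proof (cases "\<forall>i<3. e i \<le> int CARD('n)")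
  case True
  then have "e 0 \<le> int CARD('n)" "e 1 \<le> int CARD('n)" "e 2 \<le> int CARD('n)" by auto
  then have "0 \<le> e i" if "i < 3" for i
  proof -
    have "i = 0 \<or> i = 1 \<or> i = 2" using that by auto
    then show ?thesis
      using sum \<open>e 0 \<le> int CARD('n)\<close> \<open>e 1 \<le> int CARD('n)\<close> \<open>e 2 \<le> int CARD('n)\<close>
      unfolding sum_less_3 by (elim disjE) auto
  qed
  then show ?thesis using True transversal_steps(1)[OF adm _ sum] by (simp add: in_range_def)
next
  case False
  then obtain i where i: "i < 3" "e i > int CARD('n)" by auto
  obtain j where j: "j < 3" "i \<noteq> j"
  proof -
    show thesis using that[of 0] that[of 1] by (cases "i = 0") auto
  qed
  obtain k where ijk: "{i, j, k} = {..<3}" using third_index[OF i(1) j] by blast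
  then have k: "k < 3" by blast
  note d = three_indices_distinct[OF ijk]
  have s: "e i + e j + e k = 2 * int CARD('n)" using sum unfolding sum_three_indices[OF ijk] .
  have "V e j \<inter> V e k \<subseteq> {0}"
  proof (cases "e j \<le> 0 \<or> e k \<le> 0")
    case True
    then have "V e j = {0} \<or> V e k = {0}" by (auto simp: flag_step_def)
    then show ?thesis by auto
  next
    case False
    let ?f = "e(i := e i + - int CARD('n))"
    have f: "?f i = e i - int CARD('n)" "?f j = e j" "?f k = e k" using d by auto
    have "\<forall>l\<in>{i, j, k}. 0 \<le> ?f l \<and> ?f l \<le> int CARD('n)"
      using f s i(2) False by simp
    then have "in_range ?f" unfolding ijk in_range_def by blast
    moreover have "(\<Sum>l<3. ?f l) = int CARD('n)" unfolding sum_three_indices[OF ijk] f using s by simp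
    ultimately have "V ?f j \<inter> V ?f k \<subseteq> {0}"
      using independent_steps(2)[OF admissible_shift[OF adm]] j k d by blast
    then show ?thesis unfolding f .
  qed
  moreover have "V e i = UNIV" using i by (simp add: flag_step_def)
  ultimately have "cech_exact (V e i) (V e j) (V e k)"
    using subspace_V[OF adm] j k by (intro cech_exact_full) auto
  then show ?thesis using subspace_V[OF adm] by (intro cech_exact_permute[OF _ ijk]) auto
qed

end

section \<open>General position is an open condition\<close>

lemma basis_polys_sum:
  assumes "finite A" "\<And>a. a \<in> A \<Longrightarrow> f a \<in> basis_polys"
  shows "(\<lambda>b. \<Sum>a\<in>A. f a b) \<in> basis_polys"
  using assms
  by (induction A rule: finite_induct) (simp_all add: basis_polys.const basis_polys.add)

lemma basis_polys_prod:
  assumes "finite A" "\<And>a. a \<in> A \<Longrightarrow> f a \<in> basis_polys"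
  shows "(\<lambda>b. \<Prod>a\<in>A. f a b) \<in> basis_polys"
  using assms
  by (induction A rule: finite_induct) (simp_all add: basis_polys.const basis_polys.mult)

lemma basis_polys_det:
  fixes M :: "(nat \<Rightarrow> nat \<Rightarrow> complex ^ 'n::finite) \<Rightarrow> complex ^ 'm ^ 'm::finite"
  assumes "\<And>r c. (\<lambda>b. M b $ r $ c) \<in> basis_polys"
  shows "(\<lambda>b. det (M b)) \<in> basis_polys"
  unfolding det_def
  by (intro basis_polys_sum basis_polys.mult basis_polys.const basis_polys_prod assms)
     (simp_all add: finite_permutations)

lemma basis_seq_independent:
  fixes b :: "nat \<Rightarrow> complex ^ 'n::finite"
  assumes "basis_seq b" "k \<le> CARD('n)" "(\<Sum>r<k. u r *s b r) = 0" "r < k"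
  shows "u r = 0"
proof -
  have inj: "inj_on b {..<k}" using assms(1,2) inj_on_subset unfolding basis_seq_def
    by (metis lessThan_subset_iff)
  have "vec.independent (b ` {..<k})"
    using assms(1,2) unfolding basis_seq_def by (meson image_mono lessThan_subset_iff vec.independent_mono)
  moreover have "(\<Sum>v\<in>b ` {..<k}. u (inv_into {..<k} b v) *s v) = (\<Sum>r<k. u r *s b r)"
    using inj by (simp add: sum.reindex)
  ultimately have "u (inv_into {..<k} b (b r)) = 0"
    using assms(3,4) unfolding vec.independent_explicit by auto
  then show ?thesis using inj assms(4) by simp
qed

lemma basis_seqI:
  fixes b :: "nat \<Rightarrow> complex ^ 'n::finite"
  assumes *: "\<And>u r. (\<Sum>r<CARD('n). u r *s b r) = 0 \<Longrightarrow> r < CARD('n) \<Longrightarrow> u r = 0"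
  shows "basis_seq b"
proof -
  let ?n = "CARD('n)"
  have inj: "inj_on b {..<?n}"
  proof (rule inj_onI)
    fix r s assume rs: "r \<in> {..<?n}" "s \<in> {..<?n}" "b r = b s"
    show "r = s"
    proof (rule ccontr)
      assume "r \<noteq> s"
      let ?u = "\<lambda>t. (if t = r then 1 else 0) - (if t = s then 1 else 0) :: complex"
      have "(\<Sum>t<?n. ?u t *s b t) = (\<Sum>t<?n. (if t = r then b t else 0) - (if t = s then b t else 0))"
        by (rule sum.cong) auto
      also have "\<dots> = 0" using rs by (simp add: sum_subtractf)
      finally have "?u r = 0" using *[of ?u r] rs by simp
      then show False using \<open>r \<noteq> s\<close> by simp
    qed
  qed
  have "vec.independent (b ` {..<?n})"
    unfolding vec.independent_explicit
  proof (intro conjI allI impI ballI)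
    fix c v assume c: "(\<Sum>v\<in>b ` {..<?n}. c v *s v) = 0" and "v \<in> b ` {..<?n}"
    then obtain r where "r < ?n" "v = b r" by auto
    then show "c v = 0" using *[of "\<lambda>r. c (b r)" r] c inj by (simp add: sum.reindex)
  qed simp
  then show ?thesis using inj unfolding basis_seq_def by simp
qed

lemma span_initial_segment:
  fixes b :: "nat \<Rightarrow> complex ^ 'n::finite"
  assumes "basis_seq b" "k \<le> CARD('n)"
  shows "vec.span (b ` {..<k}) = range (\<lambda>u. \<Sum>r<k. u r *s b r)"
proof
  have inj: "inj_on b {..<k}" using assms inj_on_subset unfolding basis_seq_def
    by (metis lessThan_subset_iff)
  have "(\<Sum>v\<in>b ` {..<k}. u v *s v) = (\<Sum>r<k. u (b r) *s b r)" for u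
    using inj by (simp add: sum.reindex)
  then show "vec.span (b ` {..<k}) \<subseteq> range (\<lambda>u. \<Sum>r<k. u r *s b r)"
    unfolding vec.span_finite[OF finite_imageI[OF finite_lessThan]] by auto
  show "range (\<lambda>u. \<Sum>r<k. u r *s b r) \<subseteq> vec.span (b ` {..<k})"
    by (intro image_subsetI vec.span_sum vec.span_scale vec.span_base) simp
qed

lemma dim_initial_segment:
  fixes b :: "nat \<Rightarrow> complex ^ 'n::finite"
  assumes "basis_seq b" "k \<le> CARD('n)"
  shows "vec.dim (vec.span (b ` {..<k})) = k"
proof -
  have "vec.independent (b ` {..<k})"
    using assms unfolding basis_seq_def by (meson image_mono lessThan_subset_iff vec.independent_mono)
  moreover have "inj_on b {..<k}" using assms inj_on_subset unfolding basis_seq_def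
    by (metis lessThan_subset_iff)
  ultimately show ?thesis by (simp add: vec.dim_eq_card_independent card_image)
qed

lemma flag_step_flag_of:
  fixes b :: "nat \<Rightarrow> complex ^ 'n::finite"
  assumes "basis_seq b" "K \<subseteq> {1..<CARD('n)}" "k \<in> insert 0 (insert CARD('n) K)"
  shows "flag_step (flag_of K b) (int k) = vec.span (b ` {..<k})"
proof -
  have n: "CARD('n) > 0" by simp
  consider "k = 0" | "k = CARD('n)" | "k \<in> K" "0 < k" "k < CARD('n)" using assms(2,3) by auto
  then show ?thesis
  proof cases
    case 1 then show ?thesis by (simp add: flag_step_def)
  next
    case 2
    have "vec.dim (vec.span (b ` {..<k})) = vec.dim (UNIV :: (complex ^ 'n) set)"
      unfolding vec_dim_card using dim_initial_segment[OF assms(1)] 2 by simp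
    then have "vec.span (b ` {..<k}) = UNIV" by (intro vec.subspace_dim_equal) auto
    then show ?thesis using n 2 by (simp add: flag_step_def)
  next
    case 3
    then show ?thesis by (simp add: flag_step_def flag_of_def)
  qed
qed

lemma flag_of_in_flags:
  fixes b :: "nat \<Rightarrow> complex ^ 'n::finite"
  assumes "basis_seq b" "K \<subseteq> {1..<CARD('n)}"
  shows "flag_of K b \<in> flags K"
proof -
  have "vec.dim (vec.span (b ` {..<k})) = k" if "k \<in> K" for k
    using dim_initial_segment[OF assms(1), of k] assms(2) that by fastforce
  moreover have "vec.span (b ` {..<j}) \<subseteq> vec.span (b ` {..<k})" if "j \<le> k" for j k
    using that by (intro vec.span_mono image_mono) simp
  ultimately show ?thesis unfolding flags_def flag_of_def by (auto simp del: vec.dim_span)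
qed

definition flag_triple_of :: "(nat \<Rightarrow> nat set) \<Rightarrow> (nat \<Rightarrow> nat \<Rightarrow> complex ^ 'n::finite) \<Rightarrow> 'n flag_triple" where
  "flag_triple_of K b = (\<lambda>i\<in>{..<3}. flag_of (K i) (b i))"

text \<open>
  One polynomial instead of a family of them is enough here, and then a finite conjunction of such
  conditions is again of this form, by multiplying the polynomials.
\<close>
definition principal_open :: "((nat \<Rightarrow> nat \<Rightarrow> complex ^ 'n::finite) \<Rightarrow> bool) \<Rightarrow> bool" where
  "principal_open Q \<longleftrightarrow> (\<exists>p\<in>basis_polys. \<forall>b. (\<forall>i<3. basis_seq (b i)) \<longrightarrow> (Q b \<longleftrightarrow> p b \<noteq> 0))"

lemma principal_open_True: "principal_open (\<lambda>b. True)"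
  unfolding principal_open_def by (intro bexI[of _ "\<lambda>b. 1"] basis_polys.const) simp

lemma principal_open_conj:
  assumes "principal_open P" "principal_open Q"
  shows "principal_open (\<lambda>b. P b \<and> Q b)"
proof -
  obtain p where p: "p \<in> basis_polys" "\<forall>b. (\<forall>i<3. basis_seq (b i)) \<longrightarrow> (P b \<longleftrightarrow> p b \<noteq> 0)"
    using assms(1) unfolding principal_open_def by blast
  obtain q where q: "q \<in> basis_polys" "\<forall>b. (\<forall>i<3. basis_seq (b i)) \<longrightarrow> (Q b \<longleftrightarrow> q b \<noteq> 0)"
    using assms(2) unfolding principal_open_def by blast
  show ?thesis unfolding principal_open_def
    by (rule bexI[OF _ basis_polys.mult[OF p(1) q(1)]]) (use p(2) q(2) in simp)
qed

lemma principal_open_ball: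
  assumes "finite A" "\<And>a. a \<in> A \<Longrightarrow> principal_open (Q a)"
  shows "principal_open (\<lambda>b. \<forall>a\<in>A. Q a b)"
  using assms
  by (induction A rule: finite_induct) (simp_all add: principal_open_conj principal_open_True)

lemma principal_open_imp:
  "(c \<Longrightarrow> principal_open Q) \<Longrightarrow> principal_open (\<lambda>b. c \<longrightarrow> Q b)"
  by (cases c) (simp_all add: principal_open_True)

lemma principal_open_cong:
  assumes "principal_open P" "\<And>b. (\<forall>i<3. basis_seq (b i)) \<Longrightarrow> P b \<longleftrightarrow> Q b"
  shows "principal_open Q"
  using assms unfolding principal_open_def by simp

text \<open>
  When the dimensions of the subspaces add up to the number of scalar equations, a solution is given
  by the coefficients with respect to initial segments of the bases, and these satisfy a square
  homogeneous linear system whose matrix \<open>M b\<close> is polynomial in the bases. The rows of the matrix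
  are indexed by a coordinate and an equation, the columns by the basis vectors involved,
  transported along a bijection \<open>g\<close> to the index type of the rows.
\<close>
lemma principal_open_no_relation:
  fixes \<epsilon> :: "'s::finite \<Rightarrow> nat \<Rightarrow> complex"
  assumes k: "\<And>i. i < 3 \<Longrightarrow> k i \<le> CARD('n::finite)" and sum: "(\<Sum>i<3. k i) = CARD('n) * CARD('s)"
  shows "principal_open (\<lambda>b :: nat \<Rightarrow> nat \<Rightarrow> complex ^ 'n. no_relation \<epsilon> (\<lambda>i. vec.span (b i ` {..<k i})))"
proof -
  let ?I = "Sigma {..<3} (\<lambda>i. {..<k i})"
  have "card (UNIV :: ('n \<times> 's) set) = card ?I" using sum by simp
  then obtain g :: "'n \<times> 's \<Rightarrow> nat \<times> nat" where g: "bij_betw g UNIV ?I"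
    using finite_same_card_bij[of "UNIV :: ('n \<times> 's) set" ?I] by auto
  define M :: "(nat \<Rightarrow> nat \<Rightarrow> complex ^ 'n) \<Rightarrow> complex ^ ('n \<times> 's) ^ ('n \<times> 's)" where
    "M b = (\<chi> r c. \<epsilon> (snd r) (fst (g c)) * b (fst (g c)) (snd (g c)) $ fst r)" for b
  have g_lt: "fst (g c) < 3" "snd (g c) < CARD('n)" for c
  proof -
    have "g c \<in> ?I" using g by (simp add: bij_betw_apply)
    then show "fst (g c) < 3" "snd (g c) < CARD('n)" using k[of "fst (g c)"] by auto
  qed
  have poly: "(\<lambda>b. det (M b)) \<in> basis_polys"
    using g_lt unfolding M_def
    by (intro basis_polys_det) (simp, intro basis_polys.mult basis_polys.const basis_polys.coord)
  have mult: "M b *v (\<chi> c. u (fst (g c)) (snd (g c))) =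
      (\<chi> r. (\<Sum>i<3. \<epsilon> (snd r) i *s (\<Sum>t<k i. u i t *s b i t)) $ fst r)" (is "?L = ?R") for b u
  proof -
    have "?L $ (l, s) = ?R $ (l, s)" for l s
    proof -
      let ?h = "\<lambda>(i, t). \<epsilon> s i * b i t $ l * u i t"
      have "?L $ (l, s) = (\<Sum>c\<in>UNIV. ?h (g c))"
        by (simp add: M_def matrix_vector_mult_def case_prod_unfold)
      also have "\<dots> = (\<Sum>x\<in>?I. ?h x)" by (rule sum.reindex_bij_betw[OF g])
      also have "\<dots> = (\<Sum>i<3. \<Sum>t<k i. \<epsilon> s i * b i t $ l * u i t)" by (subst sum.Sigma) auto
      also have "\<dots> = ?R $ (l, s)"
        by (simp add: sum_component sum_distrib_left mult_ac)
      finally show ?thesis .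
    qed
    then show ?thesis by (simp add: vec_eq_iff)
  qed
  have zero_iff: "M b *v (\<chi> c. u (fst (g c)) (snd (g c))) = 0 \<longleftrightarrow>
      (\<forall>s. (\<Sum>i<3. \<epsilon> s i *s (\<Sum>t<k i. u i t *s b i t)) = 0)" for b u
    unfolding mult by (auto simp: vec_eq_iff)
  have det: "det (M b) \<noteq> 0 \<longleftrightarrow> (\<forall>x. M b *v x = 0 \<longrightarrow> x = 0)" for b
    using invertible_det_nz[of "M b"] unfolding invertible_left_inverse matrix_left_invertible_ker by simp
  have "no_relation \<epsilon> (\<lambda>i. vec.span (b i ` {..<k i})) \<longleftrightarrow> det (M b) \<noteq> 0"
    if b: "\<forall>i<3. basis_seq (b i)" for b
  proof
    note span = span_initial_segment[OF b[rule_format] k]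
    assume rel: "no_relation \<epsilon> (\<lambda>i. vec.span (b i ` {..<k i}))"
    show "det (M b) \<noteq> 0" unfolding det
    proof (intro allI impI)
      fix x assume x: "M b *v x = 0"
      define u where "u i t = x $ (inv_into UNIV g (i, t))" for i t
      have xu: "x = (\<chi> c. u (fst (g c)) (snd (g c)))"
        using bij_betw_inv_into_left[OF g] by (simp add: vec_eq_iff u_def)
      let ?v = "\<lambda>i. \<Sum>t<k i. u i t *s b i t"
      have "\<forall>s. (\<Sum>i<3. \<epsilon> s i *s ?v i) = 0" using x zero_iff unfolding xu by blast
      moreover have "\<forall>i<3. ?v i \<in> vec.span (b i ` {..<k i})" using span by auto
      ultimately have v0: "?v i = 0" if "i < 3" for i
        using rel[unfolded no_relation_def, THEN spec[of _ ?v]] that by blast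
      have "u (fst (g c)) (snd (g c)) = 0" for c
      proof -
        have "g c \<in> ?I" using g by (simp add: bij_betw_apply)
        then have *: "fst (g c) < 3" "snd (g c) < k (fst (g c))" by auto
        show ?thesis by (rule basis_seq_independent[OF b[rule_format, OF *(1)] k[OF *(1)] v0[OF *(1)] *(2)])
      qed
      then show "x = 0" unfolding xu by (simp add: vec_eq_iff)
    qed
  next
    note span = span_initial_segment[OF b[rule_format] k]
    assume nz: "det (M b) \<noteq> 0"
    show "no_relation \<epsilon> (\<lambda>i. vec.span (b i ` {..<k i}))" unfolding no_relation_def
    proof (intro allI impI)
      fix v and j :: nat
      assume v: "\<forall>i<3. v i \<in> vec.span (b i ` {..<k i})" and rel: "\<forall>s. (\<Sum>i<3. \<epsilon> s i *s v i) = 0"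
        and j: "j < 3"
      have "\<exists>u. v i = (\<Sum>t<k i. u t *s b i t)" if "i < 3" for i
        using v span[OF that that] that by blast
      then obtain u where u: "\<And>i. i < 3 \<Longrightarrow> v i = (\<Sum>t<k i. u i t *s b i t)" by metis
      have "\<forall>s. (\<Sum>i<3. \<epsilon> s i *s (\<Sum>t<k i. u i t *s b i t)) = 0" using rel u by simp
      then have "M b *v (\<chi> c. u (fst (g c)) (snd (g c))) = 0" using zero_iff by blast
      then have x0: "(\<chi> c. u (fst (g c)) (snd (g c))) = (0 :: complex ^ ('n \<times> 's))" using nz det by blast
      have u0: "u (fst (g c)) (snd (g c)) = 0" for c using arg_cong[OF x0, of "\<lambda>x. x $ c"] by simp
      have "u j t = 0" if "t < k j" for t
      proof -
        have "(j, t) \<in> ?I" using that j by simp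
        then obtain c where "g c = (j, t)" using g by (metis bij_betw_imp_surj_on imageE)
        then show ?thesis using u0[of c] by simp
      qed
      then show "v j = 0" using u[OF j] by simp
    qed
  qed
  then show ?thesis unfolding principal_open_def by (intro bexI[OF _ poly]) simp
qed

lemma finite_step_dims:
  assumes "\<And>i. i < 3 \<Longrightarrow> K i \<subseteq> {1..<n}" shows "finite (step_dims n K)"
proof -
  have "finite (K i)" if "i < 3" for i using assms[OF that] finite_subset by blast
  then show ?thesis unfolding step_dims_def by (intro finite_PiE) simp_all
qed

lemma zariski_open_general_position:
  fixes K :: "nat \<Rightarrow> nat set"
  assumes K: "\<And>i. i < 3 \<Longrightarrow> K i \<subseteq> {1..<CARD('n::finite)}"
  shows "zariski_open K {W \<in> flag_triples K. general_position K (W :: 'n flag_triple)}"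
proof -
  let ?n = "CARD('n)"
  let ?S = "\<lambda>b k i. vec.span (b i ` {..<k i}) :: (complex ^ 'n) set"
  have dims: "k i \<in> insert 0 (insert ?n (K i))" if "k \<in> step_dims ?n K" "i < 3" for k i
    using that unfolding step_dims_def PiE_iff by blast
  have step: "flag_step (flag_triple_of K b i) (int (k i)) = ?S b k i"
    if "\<forall>i<3. basis_seq (b i)" "k \<in> step_dims ?n K" "i < 3" for b k i
  proof -
    have "basis_seq (b i)" using that(1,3) by blast
    then have "flag_step (flag_of (K i) (b i)) (int (k i)) = ?S b k i"
      using flag_step_flag_of[OF _ K dims] that(2,3) by blast
    then show ?thesis using that(3) by (simp add: flag_triple_of_def)
  qed
  have rel: "no_relation \<epsilon> (\<lambda>i. flag_step (flag_triple_of K b i) (int (k i))) \<longleftrightarrow> no_relation \<epsilon> (?S b k)"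
    if "\<forall>i<3. basis_seq (b i)" "k \<in> step_dims ?n K" for b k and \<epsilon> :: "'s \<Rightarrow> nat \<Rightarrow> complex"
    unfolding no_relation_def using step[OF that] by simp
  have le: "k i \<le> ?n" if "k \<in> step_dims ?n K" "i < 3" for k i
  proof -
    note dims[OF that]
    moreover have "k i \<le> ?n" if "k i \<in> K i" using subsetD[OF K[OF \<open>i < 3\<close>] that] by simp
    ultimately show ?thesis by (elim insertE) simp_all
  qed
  have "principal_open (\<lambda>b :: nat \<Rightarrow> nat \<Rightarrow> complex ^ 'n. \<forall>k\<in>step_dims ?n K.
     ((\<Sum>i<3. k i) = ?n \<longrightarrow> no_relation sum_coeff (?S b k)) \<and>
     ((\<Sum>i<3. k i) = 2 * ?n \<longrightarrow> no_relation diff_coeff (?S b k)))"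
    using le finite_step_dims[OF K]
    by (intro principal_open_ball principal_open_conj principal_open_imp principal_open_no_relation) auto
  then have "principal_open (\<lambda>b :: nat \<Rightarrow> nat \<Rightarrow> complex ^ 'n. general_position K (flag_triple_of K b))"
    by (rule principal_open_cong) (simp add: general_position_def rel)
  then obtain p :: "(nat \<Rightarrow> nat \<Rightarrow> complex ^ 'n) \<Rightarrow> complex" where p: "p \<in> basis_polys"
    "\<forall>b. (\<forall>i<3. basis_seq (b i)) \<longrightarrow> (general_position K (flag_triple_of K b) \<longleftrightarrow> p b \<noteq> 0)"
    unfolding principal_open_def by blast
  have mem: "flag_triple_of K b \<in> flag_triples K" if "\<forall>i<3. basis_seq (b i)" for b :: "nat \<Rightarrow> nat \<Rightarrow> complex ^ 'n"
  proof -
    have "flag_of (K i) (b i) \<in> flags (K i)" if "i < 3" for i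
      using flag_of_in_flags[OF _ K[OF that]] \<open>\<forall>i<3. basis_seq (b i)\<close> that by blast
    then show ?thesis unfolding flag_triples_def flag_triple_of_def by auto
  qed
  show ?thesis
    unfolding zariski_open_def
  proof (intro conjI exI[of _ "{p}"] allI impI)
    fix b :: "nat \<Rightarrow> nat \<Rightarrow> complex ^ 'n" assume "\<forall>i<3. basis_seq (b i)"
    then show "(\<lambda>i\<in>{..<3}. flag_of (K i) (b i)) \<in> {W \<in> flag_triples K. general_position K W} \<longleftrightarrow>
        (\<exists>p\<in>{p}. p b \<noteq> 0)"
      using mem p(2) unfolding flag_triple_of_def by auto
  qed (use p in auto)
qed

section \<open>Triples of flags in general position exist\<close>

lemma polynomial_vanishing:
  fixes u :: "nat \<Rightarrow> complex"
  assumes "\<And>j. j \<in> J \<Longrightarrow> (\<Sum>r<k. u r * of_nat j ^ r) = 0" "finite J" "k \<le> card J" "r < k"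
  shows "u r = 0"
proof (rule ccontr)
  assume nz: "u r \<noteq> 0"
  obtain d where d: "k = Suc d" using assms(4) by (cases k) auto
  let ?R = "{z. (\<Sum>i\<le>d. u i * z ^ i) = 0}"
  have "\<exists>i\<le>d. u i \<noteq> 0" using nz assms(4) d by (intro exI[of _ r]) simp
  then have R: "finite ?R" "card ?R \<le> d" using polyfun_rootbound[of d u] by blast+
  have "of_nat ` J \<subseteq> ?R" using assms(1) unfolding d lessThan_Suc_atMost by auto
  then have "card (of_nat ` J :: complex set) \<le> d" using R card_mono by (meson order_trans)
  moreover have "card (of_nat ` J :: complex set) = card J" by (intro card_image) (simp add: inj_on_def)
  ultimately show False using assms(3) d by simp
qed

text \<open>
  In coordinates numbered by \<open>0, \<dots>, n - 1\<close> take the standard flag (bases \<open>e\<close>), the opposite flag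
  (\<open>e'\<close>) and the flag of the basis \<open>f\<^sub>r = (0\<^sup>r, 1\<^sup>r, \<dots>, (n - 1)\<^sup>r)\<close>. The \<open>k\<close>-dimensional step of the
  last flag consists of the value vectors of polynomials of degree less than \<open>k\<close>. Membership in the
  first two flags makes coordinates vanish, and in both conditions of general position exactly as
  many coordinates of the third vector are forced to vanish as its step has dimensions. A nonzero
  polynomial of degree less than \<open>k\<close> does not have \<open>k\<close> zeros, so the third vector is \<open>0\<close>.
\<close>
lemma exists_general_position:
  fixes K :: "nat \<Rightarrow> nat set"
  assumes K: "\<And>i. i < 3 \<Longrightarrow> K i \<subseteq> {1..<CARD('n::finite)}"
  shows "\<exists>W :: 'n flag_triple. W \<in> flag_triples K \<and> general_position K W"
proof -
  let ?n = "CARD('n)"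
  obtain h :: "nat \<Rightarrow> 'n" where h: "bij_betw h {..<?n} UNIV"
    using ex_bij_betw_nat_finite[of "UNIV :: 'n set"] by (auto simp: atLeast0LessThan)
  define pos where "pos i = inv_into {..<?n} h i" for i
  have pos_h: "pos (h j) = j" if "j < ?n" for j
    using bij_betw_inv_into_left[OF h] that by (simp add: pos_def)
  have h_pos: "h (pos i) = i" "pos i < ?n" for i
    using bij_betw_inv_into_right[OF h] bij_betw_apply[OF bij_betw_inv_into[OF h]] by (auto simp: pos_def)
  have vecI: "x = 0" if "\<And>j. j < ?n \<Longrightarrow> x $ h j = 0" for x :: "complex ^ 'n"
    using that h_pos by (metis vec_eq_iff zero_index)
  define e :: "nat \<Rightarrow> complex ^ 'n" where "e r = (\<chi> i. if pos i = r then 1 else 0)" for r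
  define e' :: "nat \<Rightarrow> complex ^ 'n" where "e' r = (\<chi> i. if ?n - Suc (pos i) = r then 1 else 0)" for r
  define f :: "nat \<Rightarrow> complex ^ 'n" where "f r = (\<chi> i. of_nat (pos i) ^ r)" for r
  define b where "b i = [e, e', f] ! i" for i :: nat
  have e: "(\<Sum>r<k. u r *s e r) $ h j = (if j < k then u j else 0)" if "j < ?n" for u k j
    using that by (simp add: e_def pos_h if_distrib cong: if_cong)
  have e': "(\<Sum>r<k. u r *s e' r) $ h j = (if ?n - Suc j < k then u (?n - Suc j) else 0)"
    if "j < ?n" for u k j
    using that by (simp add: e'_def pos_h if_distrib cong: if_cong)
  have f: "(\<Sum>r<k. u r *s f r) $ h j = (\<Sum>r<k. u r * of_nat j ^ r)" if "j < ?n" for u k j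
    using that by (simp add: f_def pos_h)
  have be: "basis_seq e"
  proof (rule basis_seqI)
    fix u r assume "(\<Sum>r<?n. u r *s e r) = 0" "r < ?n"
    then show "u r = 0" using e[of r u ?n] by simp
  qed
  have be': "basis_seq e'"
  proof (rule basis_seqI)
    fix u r assume "(\<Sum>r<?n. u r *s e' r) = 0" "r < ?n"
    then show "u r = 0" using e'[of "?n - Suc r" u ?n] by simp
  qed
  have bf: "basis_seq f"
  proof (rule basis_seqI)
    fix u r assume u: "(\<Sum>r<?n. u r *s f r) = 0" and r: "r < ?n"
    show "u r = 0"
    proof (rule polynomial_vanishing[where J = "{..<?n}"])
      show "(\<Sum>r<?n. u r * of_nat j ^ r) = 0" if "j \<in> {..<?n}" for j
        using f[of j u ?n] u that by simp
    qed (use r in auto)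
  qed
  have bi: "b 0 = e" "b 1 = e'" "b 2 = f" by (simp_all add: b_def)
  have basis: "basis_seq (b i)" if "i < 3" for i
  proof -
    have "i = 0 \<or> i = 1 \<or> i = 2" using that by auto
    then show ?thesis using be be' bf bi by auto
  qed
  have "general_position K (flag_triple_of K b)"
    unfolding general_position_def
  proof (intro ballI)
    fix k assume k: "k \<in> step_dims ?n K"
    have dims: "k i \<in> insert 0 (insert ?n (K i))" if "i < 3" for i
      using k that unfolding step_dims_def PiE_iff by blast
    have le: "k i \<le> ?n" if "i < 3" for i
    proof -
      have "k i \<le> ?n" if "k i \<in> K i" using subsetD[OF K[OF \<open>i < 3\<close>] that] by simp
      then show ?thesis using dims[OF that] by (elim insertE) simp_all
    qed
    have step: "flag_step (flag_triple_of K b i) (int (k i)) = range (\<lambda>u. \<Sum>r<k i. u r *s b i r)"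
      if "i < 3" for i
      using flag_step_flag_of[OF basis K dims, OF that that that]
        span_initial_segment[OF basis le, OF that that] that
      by (simp add: flag_triple_of_def)
    have V0: "x $ h j = 0" if "x \<in> flag_step (flag_triple_of K b 0) (int (k 0))" "k 0 \<le> j" "j < ?n" for x j
      using that step[of 0] e by (auto simp: bi)
    have V1: "x $ h j = 0" if "x \<in> flag_step (flag_triple_of K b 1) (int (k 1))" "j < ?n - k 1" for x j
    proof -
      have "j < ?n" "\<not> ?n - Suc j < k 1" using that(2) by auto
      then show ?thesis using that(1) step[of 1] e' by (auto simp: bi simp del: One_nat_def)
    qed
    have V2: "x = 0" if x: "x \<in> flag_step (flag_triple_of K b 2) (int (k 2))"
      and J: "J \<subseteq> {..<?n}" "card J = k 2" "\<And>j. j \<in> J \<Longrightarrow> x $ h j = 0" for x J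
    proof -
      obtain u where u: "x = (\<Sum>r<k 2. u r *s f r)" using x step[of 2] by (auto simp: bi)
      have "u r = 0" if "r < k 2" for r
      proof (rule polynomial_vanishing[OF _ _ _ that])
        show "(\<Sum>r<k 2. u r * of_nat j ^ r) = 0" if "j \<in> J" for j
          using f[of j u "k 2"] J(1) J(3)[OF that] that unfolding u by auto
        show "finite J" using J(1) finite_subset by blast
      qed (use J in simp)
      then show ?thesis unfolding u by simp
    qed
    show "((\<Sum>i<3. k i) = ?n \<longrightarrow>
          no_relation sum_coeff (\<lambda>i. flag_step (flag_triple_of K b i) (int (k i)))) \<and>
        ((\<Sum>i<3. k i) = 2 * ?n \<longrightarrow>
          no_relation diff_coeff (\<lambda>i. flag_step (flag_triple_of K b i) (int (k i))))"
    proof (intro conjI impI)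
      assume "(\<Sum>i<3. k i) = ?n"
      then have sum: "k 0 + k 1 + k 2 = ?n" unfolding sum_less_3 .
      show "no_relation sum_coeff (\<lambda>i. flag_step (flag_triple_of K b i) (int (k i)))"
        unfolding no_relation_def
      proof (rule allI, rule impI, rule impI)
        fix v assume v: "\<forall>i<3. v i \<in> flag_step (flag_triple_of K b i) (int (k i))"
          and rel: "\<forall>s. (\<Sum>i<3. sum_coeff s i *s v i) = 0"
        have s: "v 0 + v 1 + v 2 = 0" using rel unfolding sum_less_3 by (simp add: sum_coeff_def)
        have sj: "v 0 $ h j + v 1 $ h j + v 2 $ h j = 0" for j
          using arg_cong[OF s, of "\<lambda>x. x $ h j"] by simp
        have v0: "v 0 $ h j = 0" if "k 0 \<le> j" "j < ?n" for j using V0 v that by simp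
        have v1: "v 1 $ h j = 0" if "j < ?n - k 1" for j using V1 v that by simp
        have "v 2 = 0"
        proof (rule V2)
          show "v 2 \<in> flag_step (flag_triple_of K b 2) (int (k 2))" using v by simp
          \<comment> \<open>the coordinates outside the supports of both \<open>v 0\<close> and \<open>v 1\<close>\<close>
          show "{k 0..<?n - k 1} \<subseteq> {..<?n}" by auto
          show "card {k 0..<?n - k 1} = k 2" using sum by simp
          show "v 2 $ h j = 0" if "j \<in> {k 0..<?n - k 1}" for j
          proof -
            have "k 0 \<le> j" "j < ?n" "j < ?n - k 1" using that by auto
            then show ?thesis using sj[of j] v0[of j] v1[of j] by simp
          qed
        qed
        moreover have "v 0 = 0"
        proof (rule vecI)
          fix j assume "j < ?n"
          show "v 0 $ h j = 0"
          proof (cases "k 0 \<le> j")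
            case False
            then show ?thesis using sj[of j] v1[of j] sum \<open>v 2 = 0\<close> by simp
          qed (use v0 \<open>j < ?n\<close> in simp)
        qed
        ultimately have "v 0 = 0 \<and> v 1 = 0 \<and> v 2 = 0" using s by simp
        then show "\<forall>i<3. v i = 0" unfolding all_less_3 .
      qed
    next
      assume "(\<Sum>i<3. k i) = 2 * ?n"
      then have sum: "k 0 + k 1 + k 2 = 2 * ?n" unfolding sum_less_3 .
      show "no_relation diff_coeff (\<lambda>i. flag_step (flag_triple_of K b i) (int (k i)))"
        unfolding no_relation_def
      proof (rule allI, rule impI, rule impI)
        fix v assume v: "\<forall>i<3. v i \<in> flag_step (flag_triple_of K b i) (int (k i))"
          and rel: "\<forall>s. (\<Sum>i<3. diff_coeff s i *s v i) = 0"
        have s: "v 1 = v 0" "v 2 = v 0"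
          using rel[THEN spec[of _ True]] rel[THEN spec[of _ False]] unfolding sum_less_3
          by (simp_all add: diff_coeff_def)
        have v0: "v 0 $ h j = 0" if "k 0 \<le> j" "j < ?n" for j using V0 v that by simp
        have v1: "v 0 $ h j = 0" if "j < ?n - k 1" for j
        proof -
          have "v 1 \<in> flag_step (flag_triple_of K b 1) (int (k 1))" using v by simp
          then show ?thesis using V1[OF _ that] s by simp
        qed
        have "k 2 \<le> ?n" using le by simp
        then have le': "?n - k 1 \<le> k 0" using sum by simp
        have "v 0 = 0"
        proof (rule V2)
          have "v 2 \<in> flag_step (flag_triple_of K b 2) (int (k 2))" using v by simp
          then show "v 0 \<in> flag_step (flag_triple_of K b 2) (int (k 2))" using s by simp
          \<comment> \<open>the coordinates outside the support of one of the two coordinate subspaces\<close>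
          show "{..<?n - k 1} \<union> {k 0..<?n} \<subseteq> {..<?n}" by auto
          have "{..<?n - k 1} \<inter> {k 0..<?n} = {}" using le' by auto
          then have "card ({..<?n - k 1} \<union> {k 0..<?n}) = (?n - k 1) + (?n - k 0)"
            by (simp add: card_Un_disjoint)
          then show "card ({..<?n - k 1} \<union> {k 0..<?n}) = k 2"
            using sum le[of 0] le[of 1] by simp
          show "v 0 $ h j = 0" if "j \<in> {..<?n - k 1} \<union> {k 0..<?n}" for j
            using v0[of j] v1[of j] that by auto
        qed
        then have "v 0 = 0 \<and> v 1 = 0 \<and> v 2 = 0" using s by simp
        then show "\<forall>i<3. v i = 0" unfolding all_less_3 .
      qed
    qed
  qed
  moreover have "flag_triple_of K b \<in> flag_triples K"
  proof -
    have "flag_of (K i) (b i) \<in> flags (K i)" if "i < 3" for i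
      using flag_of_in_flags[OF basis K] that by blast
    then show ?thesis unfolding flag_triples_def flag_triple_of_def by auto
  qed
  ultimately show ?thesis by blast
qed

section \<open>The Ulrich property\<close>

lemma twist_twist_toric_bundle:
  assumes "I \<subseteq> {..<3}" "I \<noteq> {}"
  shows "twist k (twist l (toric_bundle E)) I =
    toric_bundle (\<lambda>i j. if i = 2 then E i (j - (k + l)) else E i j) I"
proof -
  have "twist k (twist l (toric_bundle E)) I =
      twist k (toric_bundle (\<lambda>i j. if i = 2 then E i (j - l) else E i j)) I"
    by (simp only: twist_def[of k] twist_toric_bundle[OF assms, of l])
  also have "\<dots> = toric_bundle (\<lambda>i j. if i = 2 then E i (j - (k + l)) else E i j) I"
    unfolding twist_toric_bundle[OF assms] 
    by (rule arg_cong[of _ _ "\<lambda>E. toric_bundle E I"]) (simp add: fun_eq_iff algebra_simps)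
  finally show ?thesis .
qed

text \<open>The reason why the sum of the three indices depends only on the twist.\<close>
lemma sum_pairing_rays: "pairing m (ray 0) + pairing m (ray 1) + pairing m (ray 2) = 0"
  by (simp add: pairing_def ray_def)

text \<open>
  A numerical criterion: in degree \<open>m\<close> the indices of the three steps add up to \<open>\<Sum> c\<^sub>i + r t\<close> with
  \<open>t\<close> the total twist, and \<open>t\<close> is \<open>l - d\<close> or \<open>l - 2 d\<close> in the Ulrich condition.
\<close>
lemma (in general_flags) ulrich_if_linear_jumps:
  fixes c :: "nat \<Rightarrow> int" and r :: int
  assumes E: "\<And>i j. i < 3 \<Longrightarrow> E i j = flag_step (W i) (c i - r * j)"
    and jumps: "\<And>i j. i < 3 \<Longrightarrow> (c i - r * j) mod int CARD('n) \<in> int ` insert 0 (K i)"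
    and c: "c 0 + c 1 + c 2 = 0"
    and l: "r * (l - d) = 2 * int CARD('n)" "r * (l - 2 * d) = int CARD('n)"
  shows "ulrich d (twist l (toric_bundle E))"
proof -
  have van: "cohomology_vanishes (twist t (twist l (toric_bundle E))) p"
    if t: "r * (t + l) = int CARD('n) \<or> r * (t + l) = 2 * int CARD('n)" for t p
  proof (rule cech_cohomology_vanishes)
    let ?E = "\<lambda>i j. if i = 2 then E i (j - (t + l)) else E i j"
    show "twist t (twist l (toric_bundle E)) I = toric_bundle ?E I" if "I \<subseteq> {..<3}" "I \<noteq> {}" for I
      using twist_twist_toric_bundle[OF that] .
    have sub: "vec.subspace (E i j)" if "i < 3" for i j
      using subspace_V[of "\<lambda>i. c i - r * j" i] jumps that unfolding E[OF that] admissible_def by blast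
    then show "vec.subspace (?E i j)" if "i < 3" for i j using that by simp
    fix m
    define e where "e i = c i - r * (- pairing m (ray i) - (if i = 2 then t + l else 0))" for i
    have adm: "admissible e" using jumps unfolding admissible_def e_def by blast
    have V: "?E i (- pairing m (ray i)) = flag_step (W i) (e i)" if "i < 3" for i
      using E[OF that] E[of 2] by (simp add: e_def)
    have "(\<Sum>i<3. e i) = (c 0 + c 1 + c 2) +
        r * (pairing m (ray 0) + pairing m (ray 1) + pairing m (ray 2)) + r * (t + l)"
      unfolding sum_less_3 by (simp add: e_def algebra_simps)
    also have "\<dots> = r * (t + l)" unfolding c sum_pairing_rays by simp
    finally have "cech_exact (flag_step (W 0) (e 0)) (flag_step (W 1) (e 1)) (flag_step (W 2) (e 2))"
      using exact_sum_n[OF adm] exact_sum_2n[OF adm] t by metis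
    then show "cech_exact (?E 0 (- pairing m (ray 0))) (?E 1 (- pairing m (ray 1)))
        (?E 2 (- pairing m (ray 2)))"
      using V[of 0] V[of 1] V[of 2] by simp
  qed
  show ?thesis unfolding ulrich_def
  proof (intro conjI allI van)
    show "r * (- d + l) = int CARD('n) \<or> r * (- d + l) = 2 * int CARD('n)"
      using l(1) by (simp add: algebra_simps)
    show "r * (- 2 * d + l) = int CARD('n) \<or> r * (- 2 * d + l) = 2 * int CARD('n)"
      using l(2) by (simp add: algebra_simps)
  qed
qed

text \<open>
  Per unit of \<open>j\<close> the dimension of a proper step drops by two, and by one for the complete flags of
  \<open>filt4\<close>. The linear formula is at most \<open>0\<close> or at least \<open>n\<close> exactly where the filtration is \<open>0\<close> or
  \<open>E\<close>.
\<close>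
lemma filt3_linear: "filt3 W i j = flag_step (W i) ((if i = 2 then -2 else 1) - 2 * j)"
proof -
  consider "j \<le> -4" | "j = -3" | "j = -2" | "j = -1" | "j = 0" | "j \<ge> 1" by linarith
  then show ?thesis by cases (auto simp: filt3_def flag_step_def)
qed

lemma filt4_linear: "filt4 W i j = flag_step (W i) (- j)"
proof -
  consider "j \<le> -4" | "j = -3" | "j = -2" | "j = -1" | "j \<ge> 0" by linarith
  then show ?thesis by cases (auto simp: filt4_def flag_step_def)
qed

lemma ulrich_bundle3:
  assumes "W \<in> flag_triples dims3" "general_position dims3 W"
  shows "ulrich 3 (twist 9 (bundle3 W))"
proof -
  interpret general_flags dims3 W
    by standard (use assms in \<open>auto simp: dims3_def\<close>)
  show ?thesis unfolding bundle3_def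
  proof (rule ulrich_if_linear_jumps[where c = "\<lambda>i. if i = 2 then -2 else 1" and r = 2])
    show "((if i = 2 then -2 else 1) - 2 * j) mod int CARD(6) \<in> int ` insert 0 (dims3 i)" for i :: nat and j
    proof -
      have "(-2 - 2 * j) mod 6 \<in> {0, 2, 4}" "(1 - 2 * j) mod 6 \<in> {1, 3, 5}"
        unfolding insert_iff empty_iff by presburger+
      then show ?thesis by (auto simp: dims3_def)
    qed
  qed (auto simp: filt3_linear)
qed

lemma ulrich_bundle4:
  assumes "W \<in> flag_triples dims4" "general_position dims4 W"
  shows "ulrich 4 (twist 12 (bundle4 W))"
proof -
  interpret general_flags dims4 W
    by standard (use assms in \<open>auto simp: dims4_def\<close>)
  show ?thesis unfolding bundle4_def
  proof (rule ulrich_if_linear_jumps[where c = "\<lambda>i. 0" and r = 1])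
    show "(0 - 1 * j) mod int CARD(4) \<in> int ` insert 0 (dims4 i)" for i :: nat and j
    proof -
      have "(- j) mod 4 \<in> {0, 1, 2, 3}" unfolding insert_iff empty_iff by presburger
      then show ?thesis by (auto simp: dims4_def)
    qed
  qed (auto simp: filt4_linear)
qed

theorem lemma5p5:
  shows "(\<exists>U. zariski_open dims3 U \<and> U \<noteq> {} \<and> (\<forall>W\<in>U. ulrich 3 (twist 9 (bundle3 W)))) \<and>
         (\<exists>U. zariski_open dims4 U \<and> U \<noteq> {} \<and> (\<forall>W\<in>U. ulrich 4 (twist 12 (bundle4 W))))"
proof (intro conjI exI)
  have K3: "\<And>i. i < 3 \<Longrightarrow> dims3 i \<subseteq> {1..<CARD(6)}" by (auto simp: dims3_def)
  have K4: "\<And>i. i < 3 \<Longrightarrow> dims4 i \<subseteq> {1..<CARD(4)}" by (auto simp: dims4_def)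
  let ?U3 = "{W \<in> flag_triples dims3. general_position dims3 (W :: 6 flag_triple)}"
  let ?U4 = "{W \<in> flag_triples dims4. general_position dims4 (W :: 4 flag_triple)}"
  show "zariski_open dims3 ?U3" by (rule zariski_open_general_position) (rule K3)
  have "\<exists>W :: 6 flag_triple. W \<in> flag_triples dims3 \<and> general_position dims3 W"
    by (rule exists_general_position) (rule K3)
  then show "?U3 \<noteq> {}" by simp
  show "\<forall>W\<in>?U3. ulrich 3 (twist 9 (bundle3 W))" by (simp add: ulrich_bundle3)
  show "zariski_open dims4 ?U4" by (rule zariski_open_general_position) (rule K4)
  have "\<exists>W :: 4 flag_triple. W \<in> flag_triples dims4 \<and> general_position dims4 W"
    by (rule exists_general_position) (rule K4)
  then show "?U4 \<noteq> {}" by simp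
  show "\<forall>W\<in>?U4. ulrich 4 (twist 12 (bundle4 W))" by (simp add: ulrich_bundle4)
qed

end
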